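(* Fix a prime $p\geq 3$. There exists $N$ such that for all integers $n>N$, $w_p(A_n)=2$.
   Context: $A_n$ is the alternating group of degree $n$. For a finite group $G$ and a prime $p$ dividing $|G|$, $I_p(G)$ denotes the set of elements of $G$ of order exactly $p$. The $p$-width $w_p(G)$ is the minimal $k\in\mathbb{N}$ such that every $g\in G$ can be written as a product of at most $k$ elements of $I_p(G)$. *)

theory Defs
  imports "HOL-Algebra.Sym_Groups" "HOL-Algebra.Multiplicative_Group"
    "HOL-Computational_Algebra.Primes" "HOL-Library.Extended_Nat"
begin

definition elements_of_order :: "nat \<Rightarrow> ('a, 'b) monoid_scheme \<Rightarrow> 'a set"
  where "elements_of_order p G = {x \<in> carrier G. group.ord G x = p}"

(* The empty list is allowed, with product the identity. *)
definition product_of_at_most ::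
    "('a, 'b) monoid_scheme \<Rightarrow> 'a set \<Rightarrow> nat \<Rightarrow> 'a \<Rightarrow> bool"
  where "product_of_at_most G S k g \<longleftrightarrow>
    (\<exists>xs. length xs \<le> k \<and> set xs \<subseteq> S \<and> g = foldr (\<otimes>\<^bsub>G\<^esub>) xs \<one>\<^bsub>G\<^esub>)"

(* The infimum is the minimum whenever some bound k exists. If the elements of
   order p do not generate G with bounded length, it is the infimum of the empty
   set, namely infinity, so a finite value asserts that the minimum exists. *)
definition p_width :: "nat \<Rightarrow> ('a, 'b) monoid_scheme \<Rightarrow> enat"
  where "p_width p G =
    (INF k \<in> {k. \<forall>g \<in> carrier G. product_of_at_most G (elements_of_order p G) k g}. enat k)"

end

theory Submission
  imports Defs "HOL-Library.Multiset"
begin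

text \<open>Write a permutation as a product of disjoint cycles. Cutting a cycle at points of it gives factorizations
  \<open>g = a \<circ> b\<close> in which the nontrivial cycles of \<open>a\<close> and of \<open>b\<close> come in intersecting pairs of equal lengths:
  an odd cycle of length \<open>2 (x\<^sub>1 + \<dots> + x\<^sub>k) + 1\<close> yields pairs of lengths \<open>x\<^sub>1 + 1, \<dots>, x\<^sub>k + 1\<close>, and two even cycles
  yield such pairs together with a pair of 3-cycles. If \<open>s\<close> and \<open>s'\<close> are common points of two pairs, then
  replacing \<open>a\<close> by \<open>a \<circ> (s s')\<close> and \<open>b\<close> by \<open>(s s') \<circ> b\<close> merges the two pairs and adds their lengths. Hence it
  suffices to find pairs of small lengths which can be grouped into sums equal to \<open>p\<close>.

  For \<open>p = 2 q - 1 \<ge> 5\<close> only lengths 2, 3 and 5 are used; the grouping exists as soon as one integer, the excess,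
  is 0. Very long cycles, as well as many cycles of the same length, can be factorized with any prescribed
  excess, and every type of even permutations of large degree contains one of the two after
  removing cycles that factorize separately and leave a bounded rest. For \<open>p = 3\<close> every cycle decomposes
  directly into 3-cycles used alternately in \<open>a\<close> and in \<open>b\<close>. Conversely a product of
  two disjoint transpositions is neither trivial nor of order \<open>p\<close>.\<close>

section \<open>Products of disjoint cycles\<close>

abbreviation cyc :: "'a list \<Rightarrow> 'a \<Rightarrow> 'a" where "cyc \<equiv> cycle_of_list"

section \<open>Rotating and cutting a single cycle\<close>

lemma cyc_rotate: "distinct (u @ v) \<Longrightarrow> cyc (u @ v) = cyc (v @ u)"
  using cycle_of_list_rotate_independent[of "u @ v" "length u"] by (simp add: rotate_append)

text \<open>Cutting a cycle at \<open>z\<close> gives two cycles that meet only in \<open>z\<close>.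
  The induction peels the first arc \<open>w\<close> off as a sequence of transpositions.\<close>

lemma cyc_split:
  assumes "distinct (w @ z # r)"
  shows "cyc (w @ z # r) = cyc (z # w) \<circ> cyc (z # r)"
  using assms
proof (induction w)
  case (Cons i w)
  \<comment> \<open>\<open>h\<close> is the point following \<open>i\<close>. It is the same in the
    whole cycle and in the rotated arc, also for empty \<open>w\<close>, where
    \<open>h = z\<close>.\<close>
  obtain h t where h: "w @ z # r = h # t" "\<exists>t'. w @ [z] = h # t'" by (cases w) auto
  then obtain t' where t': "w @ [z] = h # t'" by blast
  have "cyc (z # i # w) = cyc (i # w @ [z])"
    using cyc_rotate[of "[z]" "i # w"] Cons.prems by auto
  also have "\<dots> = transpose i h \<circ> cyc (w @ [z])" by (simp add: t')
  also have "cyc (w @ [z]) = cyc (z # w)"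
    using cyc_rotate[of w "[z]"] Cons.prems by auto
  finally have "cyc (z # i # w) = transpose i h \<circ> cyc (z # w)" .
  moreover have "cyc ((i # w) @ z # r) = transpose i h \<circ> cyc (w @ z # r)" by (simp add: h)
  ultimately show ?case using Cons by (simp add: comp_assoc)
qed simp

text \<open>Up to rotation this is the cut at \<open>z\<close>. Read from right to left, it inserts
  an arc \<open>w\<close> in front of the point \<open>z\<close> of a shorter cycle.\<close>

lemma cyc_glue:
  assumes "distinct (u @ w @ z # r)"
  shows "cyc (u @ w @ z # r) = cyc (z # w) \<circ> cyc (u @ z # r)"
proof -
  have "cyc (u @ w @ z # r) = cyc (w @ z # (r @ u))"
    using cyc_rotate[of u "w @ z # r"] assms by simp
  also have "\<dots> = cyc (z # w) \<circ> cyc (z # (r @ u))" using assms by (intro cyc_split) auto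
  also have "cyc (z # (r @ u)) = cyc (u @ z # r)"
    using cyc_rotate[of u "z # r"] assms by (simp add: Int_commute Int_Un_distrib2 Int_Un_distrib)
  finally show ?thesis .
qed

fun prodc :: "'a list list \<Rightarrow> 'a \<Rightarrow> 'a" where
  "prodc [] = id"
| "prodc (c # cs) = cyc c \<circ> prodc cs"

lemma prodc_notin: "x \<notin> set (concat cs) \<Longrightarrow> prodc cs x = x"
  by (induction cs) (auto simp: id_outside_supp)

lemma cyc_in: "cyc c x \<in> set c \<longleftrightarrow> x \<in> set c"
  by (meson cycle_permutes permutes_in_image)

lemma prodc_in:
  "distinct (concat cs) \<Longrightarrow> c \<in> set cs \<Longrightarrow> x \<in> set c \<Longrightarrow> prodc cs x = cyc c x"
proof (induction cs)
  case (Cons d cs)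
  show ?case
  proof (cases "x \<in> set d")
    case True
    then have "x \<notin> set (concat cs)" using Cons.prems by auto
    moreover from this have "c = d" using Cons.prems by auto
    ultimately show ?thesis by (simp add: prodc_notin del: set_concat)
  next
    case False
    then have "c \<in> set cs" using Cons.prems by auto
    moreover have "cyc c x \<in> set c" using Cons.prems cyc_in by metis
    ultimately show ?thesis using Cons by (auto intro!: id_outside_supp)
  qed
qed simp

lemma prodc_permutes: "prodc cs permutes set (concat cs)"
proof (induction cs)
  case (Cons c cs)
  have "cyc c permutes set (concat (c # cs))" by (rule permutes_subset[OF cycle_permutes]) auto
  moreover have "prodc cs permutes set (concat (c # cs))" by (rule permutes_subset[OF Cons]) auto
  ultimately show ?case using permutes_compose[of "prodc cs" _ "cyc c"] by (simp only: prodc.simps)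
qed (simp add: permutes_id id_def[symmetric])

lemma prodc_in_iff: "prodc cs x \<in> set (concat cs) \<longleftrightarrow> x \<in> set (concat cs)"
  by (meson prodc_permutes permutes_in_image)

lemma prodc_append: "prodc (cs @ ds) = prodc cs \<circ> prodc ds"
  by (induction cs) (auto simp: comp_assoc)

lemma prodc_commute:
  assumes "set (concat cs) \<inter> set (concat ds) = {}"
  shows "prodc cs \<circ> prodc ds = prodc ds \<circ> prodc cs"
proof
  fix x
  show "(prodc cs \<circ> prodc ds) x = (prodc ds \<circ> prodc cs) x"
    using assms prodc_in_iff[of cs x] prodc_in_iff[of ds x] prodc_notin
    by (smt (verit) comp_apply disjoint_iff)
qed

lemma distinct_concat_mset:
  assumes "mset cs = mset ds" "distinct (concat cs)" shows "distinct (concat ds)"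
proof -
  have "mset (concat cs) = mset (concat ds)" using assms(1) by (metis mset_concat mset_map sum_mset_sum_list)
  then show ?thesis using assms(2) mset_eq_imp_distinct_iff by blast
qed

text \<open>The value at a point depends only on the cycle through it.\<close>

lemma prodc_mset:
  assumes "mset cs = mset ds" "distinct (concat cs)" shows "prodc cs = prodc ds"
proof
  fix x
  have s: "set cs = set ds" using assms(1) mset_eq_setD by blast
  have d: "distinct (concat ds)" by (rule distinct_concat_mset[OF assms])
  show "prodc cs x = prodc ds x"
  proof (cases "x \<in> set (concat cs)")
    case True
    then obtain c where "c \<in> set cs" "x \<in> set c" by auto
    then show ?thesis using prodc_in[OF assms(2)] prodc_in[OF d] s by simp
  next
    case False
    then show ?thesis using s by (simp add: prodc_notin)
  qed
qed

text \<open>Applied later with cycle lengths 1 and \<open>p\<close> to show that the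
  \<open>p\<close>-th power of a factor is trivial.\<close>

lemma prodc_root:
  assumes "distinct (concat cs)" "\<forall>c\<in>set cs. length c dvd n"
  shows "prodc cs ^^ n = id"
proof
  fix x
  show "(prodc cs ^^ n) x = id x"
  proof (cases "x \<in> set (concat cs)")
    case True
    then obtain c where c: "c \<in> set cs" "x \<in> set c" by auto
    have "(prodc cs ^^ k) x = (cyc c ^^ k) x \<and> (cyc c ^^ k) x \<in> set c" for k
      using c by (induction k) (auto simp: prodc_in[OF assms(1)] cyc_in)
    moreover have "cyc c ^^ n = id"
    proof -
      obtain k where "n = length c * k" using c assms(2) by (auto elim: dvdE)
      moreover have "distinct c" using c assms(1) by (auto dest!: split_list)
      ultimately show ?thesis using cycle_is_id_root[of c] by (metis funpow_mult id_funpow)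
    qed
    ultimately show ?thesis by simp
  next
    case False
    then have "(prodc cs ^^ k) x = x" for k
      by (induction k) (auto simp: prodc_notin simp del: set_concat)
    then show ?thesis by simp
  qed
qed

section \<open>Factorizations with intersecting pairs of cycles\<close>

abbreviation pts :: "'a list list \<Rightarrow> 'a set" where "pts cs \<equiv> set (concat cs)"

section \<open>Merging two disjoint cycles by a transposition\<close>

text \<open>After rotation the cycles start at \<open>s\<close> and \<open>s'\<close>. Composing
  \<open>cyc A\<close> with the transposition appends \<open>s'\<close> to it by
  \<open>cyc_split\<close>, and \<open>cyc A'\<close> then inserts its remaining points in front of
  \<open>s'\<close> by \<open>cyc_glue\<close>.\<close>

lemma merge_right:
  assumes "distinct (concat (A # A' # L))" "s \<in> set A" "s' \<in> set A'"
  obtains C where "set C = set A \<union> set A'" "length C = length A + length A'"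
    "distinct (concat (C # L))" "prodc (A # A' # L) \<circ> transpose s s' = prodc (C # L)"
proof -
  obtain u v where A: "A = u @ s # v" using assms(2) by (meson split_list)
  obtain u' v' where A': "A' = u' @ s' # v'" using assms(3) by (meson split_list)
  define x y where "x = v @ u" and "y = v' @ u'"
  have cA: "cyc A = cyc (s # x)" "cyc A' = cyc (s' # y)"
  proof -
    have "distinct A" "distinct A'" using assms(1) by auto
    then show "cyc A = cyc (s # x)" "cyc A' = cyc (s' # y)"
      using cyc_rotate[of u "s # v"] cyc_rotate[of u' "s' # v'"] by (simp_all add: A A' x_def y_def)
  qed
  define C where "C = (x @ [s]) @ y @ s' # []"
  have dC: "distinct C" "distinct (x @ s # [s'])" using assms(1) by (auto simp: C_def A A' x_def y_def)
  have 1: "cyc A (cyc A' x) = cyc A' (cyc A x)" for x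
    using prodc_commute[of "[A]" "[A']"] assms(1) by (auto simp: fun_eq_iff)
  have "prodc (A # A' # L) \<circ> transpose s s' = prodc (C # L)"
  proof
    fix v
    have 2: "cyc A (transpose s s' v) = cyc (x @ s # [s']) v" for v
      using cyc_split[OF dC(2)] by (simp add: cA)
    have 3: "cyc A' (cyc (x @ s # [s']) v) = cyc C v" for v
      using cyc_glue[of "x @ [s]" y s' "[]"] dC(1) by (simp add: cA C_def)
    have 4: "prodc L (transpose s s' v) = transpose s s' (prodc L v)" for v
      using prodc_commute[of L "[[s, s']]"] assms by (auto simp: fun_eq_iff)
    show "(prodc (A # A' # L) \<circ> transpose s s') v = prodc (C # L) v"
      by (simp only: prodc.simps o_apply 1 2 3 4)
  qed
  moreover have "set C = set A \<union> set A'" "length C = length A + length A'"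
    by (auto simp: C_def A A' x_def y_def)
  moreover have "distinct (concat (C # L))" using assms(1) by (auto simp: C_def A A' x_def y_def)
  ultimately show thesis using that by blast
qed

text \<open>The mirror image of \<open>merge_right\<close>, for the second factor of a
  factorization.\<close>

lemma merge_left:
  assumes "distinct (concat (B # B' # L))" "s \<in> set B" "s' \<in> set B'"
  obtains C where "set C = set B \<union> set B'" "length C = length B + length B'"
    "distinct (concat (C # L))" "transpose s s' \<circ> prodc (B # B' # L) = prodc (C # L)"
proof -
  obtain u v where B: "B = u @ s # v" using assms(2) by (meson split_list)
  obtain u' v' where B': "B' = u' @ s' # v'" using assms(3) by (meson split_list)
  define x y where "x = v @ u" and "y = v' @ u'"
  have cB: "cyc B = cyc (s # x)" "cyc B' = cyc (s' # y)"
  proof -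
    have "distinct B" "distinct B'" using assms(1) by auto
    then show "cyc B = cyc (s # x)" "cyc B' = cyc (s' # y)"
      using cyc_rotate[of u "s # v"] cyc_rotate[of u' "s' # v'"] by (simp_all add: B B' x_def y_def)
  qed
  define C where "C = (s # x) @ s' # y"
  have dC: "distinct C" "distinct ([s'] @ s # x)" using assms(1) by (auto simp: C_def B B' x_def y_def)
  have "transpose s s' \<circ> cyc B = cyc (s' # s # x)"
    using cyc_split[OF dC(2)] by (simp add: cB)
  moreover have "cyc (s' # s # x) \<circ> cyc B' = cyc C"
    using cyc_split[of "s # x" s' y] dC(1) by (simp add: cB C_def)
  ultimately have "transpose s s' \<circ> prodc (B # B' # L) = prodc (C # L)"
    by (simp add: comp_assoc[symmetric])
  moreover have "set C = set B \<union> set B'" "length C = length B + length B'"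
    by (auto simp: C_def B B' x_def y_def)
  moreover have "distinct (concat (C # L))" using assms(1) by (auto simp: C_def B B' x_def y_def)
  ultimately show thesis using that by blast
qed

section \<open>Factorizations and the operations on them\<close>

text \<open>Each entry of \<open>ts\<close> pairs a cycle of the first factor with a cycle of the
  second one; trivial cycles are allowed. The common point makes later merging possible, and the
  support conditions allow factorizations of separate parts to be combined.\<close>

definition fac :: "'a list list \<Rightarrow> ('a list \<times> 'a list) list \<Rightarrow> bool" where
  "fac css ts \<longleftrightarrow> distinct (concat (map fst ts)) \<and> distinct (concat (map snd ts)) \<and>
     (\<forall>t\<in>set ts. set (fst t) \<inter> set (snd t) \<noteq> {}) \<and>
     pts (map fst ts) \<subseteq> pts css \<and> pts (map snd ts) \<subseteq> pts css \<and>
     prodc css = prodc (map fst ts) \<circ> prodc (map snd ts)"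

abbreviation sizes :: "('a list \<times> 'a list) list \<Rightarrow> (nat \<times> nat) list" where
  "sizes ts \<equiv> map (\<lambda>t. (length (fst t), length (snd t))) ts"

lemma fac_mset_tokens:
  assumes "fac css ts" "mset ts = mset ts'" shows "fac css ts'"
proof -
  have m: "mset (map fst ts) = mset (map fst ts')" "mset (map snd ts) = mset (map snd ts')" "set ts = set ts'"
    using assms(2) mset_eq_setD[OF assms(2)] by simp_all
  have d: "distinct (concat (map fst ts))" "distinct (concat (map snd ts))"
    using assms(1) by (simp_all add: fac_def)
  note distinct_concat_mset[OF m(1) d(1)] distinct_concat_mset[OF m(2) d(2)]
  then show ?thesis
    using assms(1) m(3) unfolding fac_def prodc_mset[OF m(1) d(1)] prodc_mset[OF m(2) d(2)] by simp
qed

lemma fac_mset_cycles: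
  assumes "fac css ts" "mset css = mset css'" "distinct (concat css)" shows "fac css' ts"
  using assms prodc_mset[OF assms(2,3)] mset_eq_setD[OF assms(2)] unfolding fac_def by simp

text \<open>In the composite of the two factorizations only the inner factors, the second factor of
  \<open>css2\<close> and the first factor of \<open>css1\<close>, have to be exchanged.\<close>

lemma prodc_fac_comp:
  assumes "fac css1 ts1" "fac css2 ts2"
    "pts (map fst ts1) \<inter> pts (map snd ts2) = {}"
  shows "prodc css2 \<circ> prodc css1 = prodc (map fst (ts2 @ ts1)) \<circ> prodc (map snd (ts2 @ ts1))"
proof -
  have "prodc (map fst ts1) \<circ> prodc (map snd ts2) = prodc (map snd ts2) \<circ> prodc (map fst ts1)"
    by (rule prodc_commute[OF assms(3)])
  then have "prodc (map fst ts1) (prodc (map snd ts2) x) = prodc (map snd ts2) (prodc (map fst ts1) x)" for x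
    by (simp add: fun_eq_iff)
  then show ?thesis using assms(1,2) unfolding fac_def by (simp add: prodc_append fun_eq_iff)
qed

lemma fac_union:
  assumes "fac css1 ts1" "fac css2 ts2" "pts css1 \<inter> pts css2 = {}"
  shows "fac (css1 @ css2) (ts1 @ ts2)"
proof -
  have sub: "pts (map fst ts1) \<subseteq> pts css1" "pts (map snd ts1) \<subseteq> pts css1"
    "pts (map fst ts2) \<subseteq> pts css2" "pts (map snd ts2) \<subseteq> pts css2"
    using assms(1,2) unfolding fac_def by blast+
  have "prodc css1 \<circ> prodc css2 = prodc (map fst (ts1 @ ts2)) \<circ> prodc (map snd (ts1 @ ts2))"
    by (rule prodc_fac_comp[OF assms(2,1)]) (use sub assms(3) in blast)
  moreover have "distinct (concat (map fst (ts1 @ ts2)))" "distinct (concat (map snd (ts1 @ ts2)))"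
    using assms sub unfolding fac_def by (simp_all del: set_concat) blast+
  ultimately show ?thesis using assms unfolding fac_def by (auto simp: prodc_append)
qed

text \<open>The two supports share at most \<open>z\<close>. Since \<open>z\<close> is missing from
  the first factor on one side and from the second factor on the other side, the inner factors
  commute, and the cycles collected in each factor stay disjoint.\<close>

lemma fac_glue:
  assumes "fac ((u @ z # r) # css1) ts1" "fac ((z # w) # css2) ts2"
    "distinct (concat ((u @ w @ z # r) # css1 @ css2))"
    "z \<notin> pts (map fst ts1)" "z \<notin> pts (map snd ts2)"
  shows "fac ((u @ w @ z # r) # css1 @ css2) (ts1 @ ts2)"
proof -
  have sub: "pts (map fst ts1) \<subseteq> set (u @ z # r) \<union> pts css1" "pts (map snd ts1) \<subseteq> set (u @ z # r) \<union> pts css1"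
    "pts (map fst ts2) \<subseteq> set (z # w) \<union> pts css2" "pts (map snd ts2) \<subseteq> set (z # w) \<union> pts css2"
    using assms(1,2) unfolding fac_def by auto
  have dis: "(set (u @ z # r) \<union> pts css1) \<inter> (set (z # w) \<union> pts css2) \<subseteq> {z}"
    using assms(3) by auto
  have d: "pts (map fst ts1) \<inter> pts (map fst ts2) = {}" "pts (map snd ts1) \<inter> pts (map snd ts2) = {}"
    "pts (map fst ts1) \<inter> pts (map snd ts2) = {}"
    using sub dis assms(4,5) by blast+
  have "prodc css2 \<circ> (cyc (u @ z # r) \<circ> prodc css1) = (cyc (u @ z # r) \<circ> prodc css1) \<circ> prodc css2"
  proof -
    have "pts css2 \<inter> pts ((u @ z # r) # css1) = {}" using assms(3) by auto
    then show ?thesis using prodc_commute[of css2 "(u @ z # r) # css1"] by simp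
  qed
  moreover have "cyc (u @ w @ z # r) = cyc (z # w) \<circ> cyc (u @ z # r)"
    using assms(3) by (intro cyc_glue) auto
  ultimately have "prodc ((u @ w @ z # r) # css1 @ css2) = prodc ((z # w) # css2) \<circ> prodc ((u @ z # r) # css1)"
    by (simp only: prodc.simps prodc_append comp_assoc)
  also have "\<dots> = prodc (map fst (ts2 @ ts1)) \<circ> prodc (map snd (ts2 @ ts1))"
    by (rule prodc_fac_comp[OF assms(1,2) d(3)])
  finally have "fac ((u @ w @ z # r) # css1 @ css2) (ts2 @ ts1)"
    using assms(1,2) d sub unfolding fac_def by auto
  then show ?thesis by (rule fac_mset_tokens) simp
qed

text \<open>One transposition, inserted twice between the factors, acts once on each of them. The
  merged cycles still have common points, so merging can be repeated.\<close>

lemma fac_merge: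
  assumes "fac css (t # t' # ts)"
  obtains C D where "fac css ((C, D) # ts)" "length C = length (fst t) + length (fst t')"
    "length D = length (snd t) + length (snd t')"
    "set C = set (fst t) \<union> set (fst t')" "set D = set (snd t) \<union> set (snd t')"
proof -
  obtain A B A' B' where t: "t = (A, B)" "t' = (A', B')" by (metis surj_pair)
  obtain s s' where s: "s \<in> set A" "s \<in> set B" "s' \<in> set A'" "s' \<in> set B'"
    using assms unfolding fac_def t by auto
  obtain C where C: "set C = set A \<union> set A'" "length C = length A + length A'"
    "distinct (concat (C # map fst ts))" "prodc (A # A' # map fst ts) \<circ> transpose s s' = prodc (C # map fst ts)"
    using merge_right[of A A' "map fst ts" s s'] assms s unfolding fac_def t by auto
  obtain D where D: "set D = set B \<union> set B'" "length D = length B + length B'"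
    "distinct (concat (D # map snd ts))" "transpose s s' \<circ> prodc (B # B' # map snd ts) = prodc (D # map snd ts)"
    using merge_left[of B B' "map snd ts" s s'] assms s unfolding fac_def t by auto
  have "prodc css = prodc (A # A' # map fst ts) \<circ> (transpose s s' \<circ> transpose s s') \<circ> prodc (B # B' # map snd ts)"
    using assms unfolding fac_def t by simp
  also have "\<dots> = prodc (C # map fst ts) \<circ> prodc (D # map snd ts)"
    unfolding C(4)[symmetric] D(4)[symmetric] by (simp only: comp_assoc)
  finally have "fac css ((C, D) # ts)" using assms C D s unfolding fac_def t by auto
  then show thesis using that C D by (simp add: t)
qed

text \<open>\<open>x\<close> is fixed by the second factor and \<open>y\<close> by the first one, so both can be regarded as
  trivial cycles, which are merged into the cycles of the token.\<close>

lemma fac_fill: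
  assumes "fac css (t # ts)" "x \<in> set (fst t)" "y \<in> set (snd t)"
    "x \<notin> pts (map snd (t # ts))" "y \<notin> pts (map fst (t # ts))"
  obtains C D where "fac css ((C, D) # ts)" "length C = length (fst t) + 1" "length D = length (snd t) + 1"
proof -
  obtain A B where t: "t = (A, B)" by (metis surj_pair)
  have d: "distinct (concat (A # [y] # map fst ts))" "distinct (concat ([x] # B # map snd ts))"
    using assms unfolding fac_def t by auto
  obtain C where C: "set C = set A \<union> set [y]" "length C = length A + length [y]"
    "distinct (concat (C # map fst ts))" "prodc (A # [y] # map fst ts) \<circ> transpose x y = prodc (C # map fst ts)"
    using merge_right[OF d(1), of x y] assms(2) unfolding t by auto
  obtain D where D: "set D = set [x] \<union> set B" "length D = length [x] + length B"
    "distinct (concat (D # map snd ts))" "transpose x y \<circ> prodc ([x] # B # map snd ts) = prodc (D # map snd ts)"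
    using merge_left[OF d(2), of x y] assms(3) unfolding t by auto
  have "prodc css = prodc (A # [y] # map fst ts) \<circ> (transpose x y \<circ> transpose x y) \<circ> prodc ([x] # B # map snd ts)"
    using assms(1) unfolding fac_def t by simp
  also have "\<dots> = prodc (C # map fst ts) \<circ> prodc (D # map snd ts)"
    unfolding C(4)[symmetric] D(4)[symmetric] by (simp only: comp_assoc)
  finally have "fac css ((C, D) # ts)" using assms C D unfolding fac_def t by auto
  then show thesis using that C D by (simp add: t)
qed

section \<open>Cutting odd cycles and pairs of even cycles\<close>

abbreviation stars :: "nat list \<Rightarrow> (nat \<times> nat) list" where
  "stars xs \<equiv> map (\<lambda>x. (x + 1, x + 1)) xs"

lemma fac_star:
  assumes "distinct (w @ z # r)"
  shows "fac [w @ z # r] [(z # w, z # r)]"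
  using assms cyc_split[OF assms] unfolding fac_def by auto

text \<open>An arc of \<open>2 * x\<close> points together with the end point \<open>z\<close> is an
  odd cycle, cut at its midpoint and glued at \<open>z\<close> to the factorization of the rest. The
  head is left idle by the second factor and the point at position \<open>k\<close> by the first
  one; further pieces can be attached there. \<open>k\<close> is chosen before the cycle, because
  later constructions cut next to this position.\<close>

lemma ex_fac_chain:
  assumes "\<forall>x\<in>set xs. 0 < x"
  shows "\<exists>k<2 * sum_list xs + 1. \<forall>cs::'a list. distinct cs \<longrightarrow> length cs = 2 * sum_list xs + 1 \<longrightarrow>
    (\<exists>ts. fac [cs] ts \<and> sizes ts = stars xs \<and> hd cs \<notin> pts (map snd ts) \<and> cs ! k \<notin> pts (map fst ts) \<and>
      (xs \<noteq> [] \<longrightarrow> hd cs \<in> set (fst (hd ts)) \<and> cs ! k \<in> set (snd (last ts))))"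
  using assms
proof (induction xs)
  case Nil
  have "\<exists>ts. fac [cs] ts \<and> sizes ts = stars [] \<and> hd cs \<notin> pts (map snd ts) \<and> cs ! 0 \<notin> pts (map fst ts)"
    if "length cs = 1" for cs :: "'a list"
    using that by (intro exI[of _ "[]"]) (auto simp: fac_def length_Suc_conv)
  then show ?case by auto
next
  case (Cons x ys)
  have x: "0 < x" using Cons.prems by simp
  obtain k where k: "k < 2 * sum_list ys + 1" and IH: "\<And>cs::'a list. distinct cs \<Longrightarrow>
    length cs = 2 * sum_list ys + 1 \<Longrightarrow>
    \<exists>ts. fac [cs] ts \<and> sizes ts = stars ys \<and> hd cs \<notin> pts (map snd ts) \<and> cs ! k \<notin> pts (map fst ts) \<and>
      (ys \<noteq> [] \<longrightarrow> hd cs \<in> set (fst (hd ts)) \<and> cs ! k \<in> set (snd (last ts)))"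
    using Cons by auto
  \<comment> \<open>Position \<open>k\<close> of \<open>z # w\<close>, expressed in
    \<open>u @ w @ [z]\<close>: the head \<open>z\<close> becomes the last entry, the others move by
    \<open>2 * x - 1\<close>.\<close>
  define k' where "k' = (if k = 0 then 2 * x + 2 * sum_list ys else 2 * x + (k - 1))"
  have "k' < 2 * sum_list (x # ys) + 1" using k by (auto simp: k'_def)
  moreover have "\<exists>ts. fac [cs] ts \<and> sizes ts = stars (x # ys) \<and> hd cs \<notin> pts (map snd ts) \<and>
      cs ! k' \<notin> pts (map fst ts) \<and> hd cs \<in> set (fst (hd ts)) \<and> cs ! k' \<in> set (snd (last ts))"
    if cs: "distinct cs" "length cs = 2 * sum_list (x # ys) + 1" for cs :: "'a list"
  proof -
    define u w where "u = take (2 * x) cs" and "w = take (2 * sum_list ys) (drop (2 * x) cs)"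
    have lu: "length u = 2 * x" "length w = 2 * sum_list ys" using cs by (auto simp: u_def w_def)
    have "length (drop (2 * x + 2 * sum_list ys) cs) = Suc 0" using cs by simp
    then obtain z where z: "drop (2 * x + 2 * sum_list ys) cs = [z]" by (metis length_0_conv length_Suc_conv)
    have "cs = u @ w @ drop (2 * sum_list ys) (drop (2 * x) cs)"
      unfolding u_def w_def append_take_drop_id ..
    then have cs_eq: "cs = u @ w @ [z]" using z by (simp add: add.commute)
    have d: "distinct (u @ w @ [z])" using cs cs_eq by simp
    \<comment> \<open>\<open>s\<close> is the midpoint of the odd cycle \<open>u @ [z]\<close>, with
      \<open>x\<close> points on either side.\<close>
    define a s b where "a = take x u" and "s = u ! x" and "b = drop (x + 1) u"
    have u_eq: "u = a @ s # b" using lu x by (simp add: a_def s_def b_def id_take_nth_drop)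
    have lab: "length a = x" "length b = x - 1" using lu x by (auto simp: a_def b_def)
    have f1: "fac [u @ z # []] [(s # a, s # b @ [z])]"
    proof -
      have "distinct (a @ s # (b @ [z]))" using d by (auto simp: u_eq)
      then show ?thesis using fac_star[of a s "b @ [z]"] by (simp add: u_eq)
    qed
    obtain ts where ts: "fac [z # w] ts" "sizes ts = stars ys" "z \<notin> pts (map snd ts)"
      "(z # w) ! k \<notin> pts (map fst ts)" "ys \<noteq> [] \<Longrightarrow> (z # w) ! k \<in> set (snd (last ts))"
      using IH[of "z # w"] d lu by auto
    have f: "fac [cs] ((s # a, s # b @ [z]) # ts)"
    proof -
      have "z \<notin> pts (map fst [(s # a, s # b @ [z])])" using d by (auto simp: u_eq)
      then show ?thesis
        using fac_glue[of u z "[]" "[]" "[(s # a, s # b @ [z])]" w "[]" ts] f1 ts(1,3) d by (simp add: cs_eq)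
    qed
    have csk: "cs ! k' = (z # w) ! k" using k lu by (cases k) (auto simp: k'_def cs_eq nth_append)
    have hdcs: "hd cs = hd a" "hd a \<in> set a" using lab x by (cases a, auto simp: cs_eq u_eq)+
    have sub: "pts (map snd ts) \<subseteq> set (z # w)" using ts(1) unfolding fac_def by auto
    have kin: "(z # w) ! k \<in> set (z # w)" using k lu by (intro nth_mem) simp
    have "hd cs \<notin> pts (map snd ((s # a, s # b @ [z]) # ts))"
      using hdcs d sub by (auto simp: u_eq)
    moreover have "cs ! k' \<notin> pts (map fst ((s # a, s # b @ [z]) # ts))"
      using ts(4) kin d unfolding csk by (auto simp: u_eq)
    moreover have "cs ! k' \<in> set (snd (last ((s # a, s # b @ [z]) # ts)))"
    proof (cases "ys = []")
      case True
      then have "ts = []" "k = 0" using ts(2) k by auto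
      then show ?thesis by (simp add: csk)
    next
      case False
      then have "ts \<noteq> []" using ts(2) by auto
      then show ?thesis using ts(5)[OF False] by (simp add: csk)
    qed
    moreover have "sizes ((s # a, s # b @ [z]) # ts) = stars (x # ys)" using ts(2) lab x by simp
    ultimately show ?thesis using f hdcs by (intro exI[of _ "(s # a, s # b @ [z]) # ts"]) auto
  qed
  ultimately show ?case by (intro exI[of _ k']) blast
qed

text \<open>The inner transpositions \<open>(e f)\<close> cancel. This pair of 3-cycles accounts for
  the parity of two even cycles.\<close>

lemma fac_two_transpositions:
  assumes "distinct [x, e, f, y]"
  shows "fac [[x, e], [f, y]] [([x, e, f], [e, f, y])]"
proof -
  have "cyc [x, e, f] = cyc [e, x] \<circ> cyc [e, f]" "cyc [e, f, y] = cyc [f, e] \<circ> cyc [f, y]"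
    using cyc_split[of "[x]" e "[f]"] cyc_split[of "[e]" f "[y]"] assms by auto
  then have "cyc [x, e, f] \<circ> cyc [e, f, y] = transpose x e \<circ> (transpose e f \<circ> transpose e f) \<circ> transpose f y"
    by (simp add: transpose_commute fun_eq_iff)
  then show ?thesis using assms unfolding fac_def by auto
qed

text \<open>Removing one point from each cycle leaves two odd cycles, which are factorized as
  chains. The removed points return with the factorization of two transpositions, glued to each
  chain at one of its idle points. The other idle points \<open>x\<close> and \<open>y\<close>
  remain available for filling.\<close>

lemma ex_fac_even_pair:
  fixes cs ds :: "'a list"
  assumes "\<forall>x\<in>set xs. 0 < x" "\<forall>x\<in>set ys. 0 < x" "distinct (cs @ ds)"
    "length cs = 2 * sum_list xs + 2" "length ds = 2 * sum_list ys + 2"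
  obtains t ts us x y where "fac [cs, ds] (t # ts @ us)" "sizes [t] = [(3, 3)]" "sizes ts = stars xs" "sizes us = stars ys"
    "x \<notin> pts (map snd (t # ts @ us))" "y \<notin> pts (map fst (t # ts @ us))"
    "xs \<noteq> [] \<Longrightarrow> x \<in> set (fst (hd ts))" "ys \<noteq> [] \<Longrightarrow> y \<in> set (snd (last us))"
proof -
  obtain k where k: "k < 2 * sum_list xs + 1" and ch1: "\<And>cs::'a list. distinct cs \<Longrightarrow>
    length cs = 2 * sum_list xs + 1 \<Longrightarrow>
    \<exists>ts. fac [cs] ts \<and> sizes ts = stars xs \<and> hd cs \<notin> pts (map snd ts) \<and> cs ! k \<notin> pts (map fst ts) \<and>
      (xs \<noteq> [] \<longrightarrow> hd cs \<in> set (fst (hd ts)) \<and> cs ! k \<in> set (snd (last ts)))"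
    using ex_fac_chain[OF assms(1), where 'a='a] by auto
  obtain m where m: "m < 2 * sum_list ys + 1" and ch2: "\<And>cs::'a list. distinct cs \<Longrightarrow>
    length cs = 2 * sum_list ys + 1 \<Longrightarrow>
    \<exists>ts. fac [cs] ts \<and> sizes ts = stars ys \<and> hd cs \<notin> pts (map snd ts) \<and> cs ! m \<notin> pts (map fst ts) \<and>
      (ys \<noteq> [] \<longrightarrow> hd cs \<in> set (fst (hd ts)) \<and> cs ! m \<in> set (snd (last ts)))"
    using ex_fac_chain[OF assms(2), where 'a='a] by auto
  \<comment> \<open>Deleting \<open>e\<close> moves \<open>v\<close> to position \<open>k\<close> of
    the shortened cycle, so \<open>v\<close> is the point missing from the first factor.\<close>
  define u e v r where "u = take k cs" and "e = cs ! k" and "v = cs ! (k + 1)" and "r = drop (k + 2) cs"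
  have cs: "cs = u @ e # v # r" using k assms(4)
    by (simp add: u_def e_def v_def r_def Cons_nth_drop_Suc)
  have lu: "length u = k" using k assms(4) by (simp add: u_def)
  define f w y where "f = hd ds" and "w = butlast (tl ds)" and "y = last ds"
  have ds: "ds = f # w @ [y]" using assms(5) by (cases ds) (auto simp: f_def w_def y_def)
  have d: "distinct (u @ e # v # r @ f # w @ [y])" using assms(3) by (simp add: cs ds)
  obtain ts where ts: "fac [u @ v # r] ts" "sizes ts = stars xs" "hd (u @ v # r) \<notin> pts (map snd ts)"
    "v \<notin> pts (map fst ts)" "xs \<noteq> [] \<Longrightarrow> hd (u @ v # r) \<in> set (fst (hd ts))"
    using ch1[of "u @ v # r"] d assms(4) by (auto simp: cs lu[symmetric])
  obtain us where us: "fac [y # w] us" "sizes us = stars ys" "y \<notin> pts (map snd us)"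
    "(y # w) ! m \<notin> pts (map fst us)" "ys \<noteq> [] \<Longrightarrow> (y # w) ! m \<in> set (snd (last us))"
    using ch2[of "y # w"] d assms(5) by (auto simp: ds)
  define t where "t = ([v, e, f], [e, f, y])"
  have "fac [[v, e], [f, y]] [t]" using fac_two_transpositions[of v e f y] d by (auto simp: t_def)
  then have "fac ((u @ [e] @ v # r) # [] @ [[f, y]]) (ts @ [t])"
    using ts(1,4) d by (intro fac_glue) (auto simp: t_def)
  then have f1: "fac [[f, y], cs] (ts @ [t])"
    by (rule fac_mset_cycles) (use d in \<open>auto simp: cs\<close>)
  have sub: "pts (map fst ts) \<subseteq> set (u @ v # r)" "pts (map snd ts) \<subseteq> set (u @ v # r)"
    "pts (map fst us) \<subseteq> set (y # w)" "pts (map snd us) \<subseteq> set (y # w)"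
    using ts(1) us(1) unfolding fac_def by auto
  have ynin: "y \<notin> pts (map fst (ts @ [t]))" using sub(1) d by (auto simp: t_def)
  have dd: "distinct (concat [f # w @ [y], cs])" using d unfolding cs by auto
  have "fac (([f] @ w @ y # []) # [cs] @ []) ((ts @ [t]) @ us)"
    by (rule fac_glue) (use f1 us(1,3) ynin dd in simp_all)
  then have "fac [f # w @ [y], cs] ((ts @ [t]) @ us)" by simp
  then have "fac [cs, ds] ((ts @ [t]) @ us)"
    unfolding ds by (rule fac_mset_cycles) (use dd in simp_all)
  then have fac: "fac [cs, ds] (t # ts @ us)"
    by (rule fac_mset_tokens) simp
  define x' y' where "x' = hd (u @ v # r)" and "y' = (y # w) ! m"
  have x'in: "x' \<in> set (u @ v # r)" unfolding x'_def by (rule hd_in_set) simp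
  have y'in: "y' \<in> set (y # w)" unfolding y'_def using m assms(5) by (intro nth_mem) (simp add: ds)
  have nin: "x' \<notin> pts (map snd (t # ts @ us))" "y' \<notin> pts (map fst (t # ts @ us))"
    using ts(3) us(4) x'in y'in sub d unfolding x'_def[symmetric] y'_def[symmetric] by (auto simp: t_def)
  have "sizes [t] = [(3, 3)]" by (simp add: t_def)
  then show thesis
    by (rule that[OF fac _ ts(2) us(2) nin]) (unfold x'_def y'_def, (erule ts(5) us(5))+)
qed

text \<open>An extra part 1 at the start of one chain and at the end of the other gives two pairs of
  transpositions that contain the idle points. Merging them yields a pair of 4-cycles, and filling
  in both idle points yields 5-cycles.\<close>

lemma ex_fac_filled_pair:
  fixes cs ds :: "'a list"
  assumes "\<forall>x\<in>set xs. 0 < x" "\<forall>x\<in>set ys. 0 < x" "distinct (cs @ ds)"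
    "length cs = 2 * sum_list xs + 4" "length ds = 2 * sum_list ys + 4"
  obtains ts where "fac [cs, ds] ts" "mset (sizes ts) = mset ((3, 3) # (5, 5) # stars xs @ stars ys)"
proof -
  obtain t ts us x y where f: "fac [cs, ds] (t # ts @ us)"
    and s: "sizes [t] = [(3, 3)]" "sizes ts = stars (1 # xs)" "sizes us = stars (ys @ [1])" and n: "x \<notin> pts (map snd (t # ts @ us))" "y \<notin> pts (map fst (t # ts @ us))"
    and m: "x \<in> set (fst (hd ts))" "y \<in> set (snd (last us))"
    by (rule ex_fac_even_pair[of "1 # xs" "ys @ [1]" cs ds]) (use assms in auto)
  obtain v ts' where ts: "ts = v # ts'" using s(2) by (cases ts) auto
  obtain us' w where us: "us = us' @ [w]" using s(3) by (cases us rule: rev_cases) auto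
  have sz: "length (fst v) = 2" "length (snd v) = 2" "length (fst w) = 2" "length (snd w) = 2"
    "sizes ts' = stars xs" "sizes us' = stars ys" "length (fst t) = 3" "length (snd t) = 3"
    using s by (auto simp: ts us)
  have "fac [cs, ds] (v # w # t # ts' @ us')"
    by (rule fac_mset_tokens[OF f]) (simp add: ts us)
  then obtain C D where CD: "fac [cs, ds] ((C, D) # t # ts' @ us')" "length C = length (fst v) + length (fst w)"
    "length D = length (snd v) + length (snd w)" "set C = set (fst v) \<union> set (fst w)" "set D = set (snd v) \<union> set (snd w)"
    by (rule fac_merge)
  have "pts (map snd ((C, D) # t # ts' @ us')) = pts (map snd (t # ts @ us))"
    "pts (map fst ((C, D) # t # ts' @ us')) = pts (map fst (t # ts @ us))"
    by (auto simp: CD ts us)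
  then have "x \<notin> pts (map snd ((C, D) # t # ts' @ us'))" "y \<notin> pts (map fst ((C, D) # t # ts' @ us'))"
    using n by simp_all
  moreover have "x \<in> set (fst (C, D))" "y \<in> set (snd (C, D))" using m by (auto simp: CD ts us)
  ultimately obtain C' D' where "fac [cs, ds] ((C', D') # t # ts' @ us')"
    "length C' = length (fst (C, D)) + 1" "length D' = length (snd (C, D)) + 1"
    using fac_fill[OF CD(1)] by metis
  then show thesis using that[of "(C', D') # t # ts' @ us'"] sz CD by simp
qed

text \<open>Two points \<open>e\<close> and \<open>f\<close> are set aside and the rest is a chain.
  Attached at the idle points, \<open>f\<close> contributes a transposition to the second factor and
  \<open>e\<close> one to the first. With trivial partners these are pairs of lengths
  \<open>(1, 2)\<close> and \<open>(2, 1)\<close>, which merge to a pair of 3-cycles.\<close>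

lemma ex_fac_odd_full:
  fixes cs :: "'a list"
  assumes "\<forall>x\<in>set xs. 0 < x" "distinct cs" "length cs = 2 * sum_list xs + 3"
  obtains ts where "fac [cs] ts" "sizes ts = (3, 3) # stars xs"
proof -
  obtain k where k: "k < 2 * sum_list xs + 1" and ch: "\<And>cs::'a list. distinct cs \<Longrightarrow>
    length cs = 2 * sum_list xs + 1 \<Longrightarrow>
    \<exists>ts. fac [cs] ts \<and> sizes ts = stars xs \<and> hd cs \<notin> pts (map snd ts) \<and> cs ! k \<notin> pts (map fst ts)"
    using ex_fac_chain[OF assms(1), where 'a='a] by blast
  \<comment> \<open>The position of the idle point \<open>(y # w) ! k\<close> in
    \<open>l = f # w @ [y]\<close>, where the head \<open>y\<close> of the chain comes last. The
    point \<open>e\<close> is cut out directly in front of it.\<close>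
  define j where "j = (if k = 0 then 2 * sum_list xs + 1 else k)"
  have j: "0 < j" "j < 2 * sum_list xs + 2" using k by (auto simp: j_def)
  define u e z r where "u = take j cs" and "e = cs ! j" and "z = cs ! (j + 1)" and "r = drop (j + 2) cs"
  have cs: "cs = u @ [e] @ z # r" using j assms(3)
    by (simp add: u_def e_def z_def r_def Cons_nth_drop_Suc)
  have lu: "length u = j" using j assms(3) by (simp add: u_def)
  define l where "l = u @ z # r"
  have ll: "length l = 2 * sum_list xs + 2" using assms(3) by (simp add: l_def cs)
  define f w y where "f = hd l" and "w = butlast (tl l)" and "y = last l"
  have l: "l = f # w @ [y]" using ll by (cases l) (auto simp: f_def w_def y_def)
  have d: "distinct l" "e \<notin> set l" using assms(2) by (auto simp: cs l_def)
  obtain ts where ts: "fac [y # w] ts" "sizes ts = stars xs" "y \<notin> pts (map snd ts)"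
    "(y # w) ! k \<notin> pts (map fst ts)"
    using ch[of "y # w"] d ll by (auto simp: l)
  have "l ! j = z" by (simp add: l_def lu[symmetric])
  moreover have "l ! j = (y # w) ! k" using k ll by (cases k) (auto simp: j_def l nth_append)
  ultimately have z: "z = (y # w) ! k" by simp
  have sub: "pts (map fst ts) \<subseteq> set (y # w)" using ts(1) unfolding fac_def by auto
  have "fac [[f, y]] [([f], [f, y])]" using d by (auto simp: fac_def l)
  then have "fac (([f] @ w @ y # []) # [] @ []) ([([f], [f, y])] @ ts)"
    by (intro fac_glue) (use ts d in \<open>auto simp: l\<close>)
  then have f1: "fac [u @ z # r] (([f], [f, y]) # ts)" by (simp add: l flip: l_def)
  have "z \<in> set (y # w)" unfolding z using k ll by (intro nth_mem) (simp add: l)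
  then have "z \<noteq> f" using d(1) by (auto simp: l)
  then have zA: "z \<notin> pts (map fst (([f], [f, y]) # ts))" using ts(4) by (simp add: z)
  have "z \<noteq> e" using d by (auto simp: l_def)
  then have f2: "fac [[z, e]] [([z, e], [e])]" "z \<notin> pts (map snd [([z, e], [e])])"
    by (auto simp: fac_def)
  have "fac ((u @ [e] @ z # r) # [] @ []) ((([f], [f, y]) # ts) @ [([z, e], [e])])"
    by (rule fac_glue[OF f1 f2(1) _ zA f2(2)]) (use assms(2) in \<open>simp add: cs\<close>)
  then have "fac [cs] (([f], [f, y]) # ([z, e], [e]) # ts)"
    by (simp add: cs) (erule fac_mset_tokens, simp)
  then obtain C D where "fac [cs] ((C, D) # ts)" "length C = 3" "length D = 3"
    by (rule fac_merge) auto
  then show thesis using that[of "(C, D) # ts"] ts(2) by simp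
qed

section \<open>Two cycles of equal length, and four transpositions\<close>

lemma cyc_nth:
  assumes "distinct c" "i < length c" shows "cyc c (c ! i) = c ! (Suc i mod length c)"
proof -
  have "map (cyc c) c = rotate1 c" using cyclic_rotation[OF assms(1), of 1] by simp
  then show ?thesis using assms(2) nth_rotate1[of i c] by (metis nth_map)
qed

lemma distinct_concat_pairs:
  "length xs = length ys \<Longrightarrow> distinct (xs @ ys) \<Longrightarrow> distinct (concat (map2 (\<lambda>x y. [x, y]) xs ys))"
  by (induction xs ys rule: list_induct2) (auto dest: set_zip_leftD set_zip_rightD)

lemma pts_pairs:
  "length xs = length ys \<Longrightarrow> pts (map2 (\<lambda>x y. [x, y]) xs ys) = set xs \<union> set ys"
  by (induction xs ys rule: list_induct2) auto

lemma prodc_pairs: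
  assumes "length xs = length ys" "distinct (xs @ ys)" "i < length xs"
  shows "prodc (map2 (\<lambda>x y. [x, y]) xs ys) (xs ! i) = ys ! i"
    "prodc (map2 (\<lambda>x y. [x, y]) xs ys) (ys ! i) = xs ! i"
proof -
  have "[xs ! i, ys ! i] \<in> set (map2 (\<lambda>x y. [x, y]) xs ys)"
    using assms(1,3) by (auto simp: set_zip image_iff intro!: exI[of _ i])
  then show "prodc (map2 (\<lambda>x y. [x, y]) xs ys) (xs ! i) = ys ! i"
    "prodc (map2 (\<lambda>x y. [x, y]) xs ys) (ys ! i) = xs ! i"
    by (simp_all add: prodc_in[OF distinct_concat_pairs[OF assms(1,2)]] del: set_map)
qed

text \<open>Both factors are fixed-point-free involutions interchanging the two cycles.\<close>

lemma ex_fac_equal_pair: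
  fixes cs ds :: "'a list"
  assumes "distinct (cs @ ds)" "length cs = l" "length ds = l"
  obtains ts where "fac [cs, ds] ts" "sizes ts = replicate l (2, 2)"
proof -
  \<comment> \<open>Modulo \<open>l\<close>, the second factor swaps \<open>cs ! i\<close> with
    \<open>es ! i\<close> and the first one swaps \<open>cs ! (i + 1)\<close> with
    \<open>es ! i\<close>. The product moves \<open>cs\<close> one step forward and
    \<open>es\<close> one step backward, hence the reversal.\<close>
  define es where "es = rev ds"
  define ts where "ts = map2 (\<lambda>(c', c) e. ([c', e], [c, e])) (zip (rotate1 cs) cs) es"
  have les: "length es = l" "set es = set ds" using assms by (auto simp: es_def)
  have fst: "map fst ts = map2 (\<lambda>x y. [x, y]) (rotate1 cs) es"
    by (rule nth_equalityI) (use assms les in \<open>auto simp: ts_def\<close>)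
  have snd: "map snd ts = map2 (\<lambda>x y. [x, y]) cs es"
    by (rule nth_equalityI) (use assms les in \<open>auto simp: ts_def\<close>)
  have d: "distinct (rotate1 cs @ es)" "distinct (cs @ es)" "distinct cs" "distinct ds"
    using assms(1) les by (auto simp: es_def)
  have cds: "prodc [cs, ds] (cs ! i) = cs ! (Suc i mod l)" if "i < l" for i
    using that assms prodc_in[of "[cs, ds]" cs "cs ! i"] cyc_nth[of cs i] by auto
  have dds: "prodc [cs, ds] (es ! (Suc i mod l)) = es ! i" if i: "i < l" for i
  proof -
    have "prodc [cs, ds] (ds ! j) = ds ! (Suc j mod l)" if "j < l" for j
      using that assms prodc_in[of "[cs, ds]" ds "ds ! j"] cyc_nth[of ds j] by auto
    note * = this[of "l - Suc (Suc i mod l)"]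
    have "Suc (l - Suc (Suc i mod l)) mod l = l - Suc i"
      using i by (cases "Suc i = l") (auto simp: Suc_diff_Suc)
    then show ?thesis using * i assms(3) by (simp add: es_def rev_nth)
  qed
  have inv: "prodc (map fst ts) (prodc (map snd ts) (cs ! i)) = cs ! (Suc i mod l)"
    "prodc (map fst ts) (prodc (map snd ts) (es ! (Suc i mod l))) = es ! i" if i: "i < l" for i
  proof -
    have m: "Suc i mod l < l" using i by simp
    have r: "rotate1 cs ! i = cs ! (Suc i mod l)" using i assms nth_rotate1 by metis
    have l: "length (rotate1 cs) = length es" "length cs = length es" "i < length cs" "i < length (rotate1 cs)"
      "Suc i mod l < length cs" using assms les i m by simp_all
    have p: "prodc (map snd ts) (cs ! i) = es ! i" "prodc (map fst ts) (es ! i) = cs ! (Suc i mod l)"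
      "prodc (map snd ts) (es ! (Suc i mod l)) = cs ! (Suc i mod l)" "prodc (map fst ts) (cs ! (Suc i mod l)) = es ! i"
      unfolding fst snd
      using prodc_pairs(1)[OF l(2) d(2) l(3)] prodc_pairs(2)[OF l(1) d(1) l(4)]
        prodc_pairs(2)[OF l(2) d(2) l(5)] prodc_pairs(1)[OF l(1) d(1) l(4)] unfolding r by blast+
    show "prodc (map fst ts) (prodc (map snd ts) (cs ! i)) = cs ! (Suc i mod l)"
      by (simp only: p)
    show "prodc (map fst ts) (prodc (map snd ts) (es ! (Suc i mod l))) = es ! i"
      by (simp only: p)
  qed
  have pts: "pts (map fst ts) = set cs \<union> set ds" "pts (map snd ts) = set cs \<union> set ds"
    unfolding fst snd using assms les by (simp_all only: pts_pairs length_rotate1 set_rotate1)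
  have "prodc [cs, ds] x = (prodc (map fst ts) \<circ> prodc (map snd ts)) x" for x
  proof -
    consider i where "i < l" "x = cs ! i" | i where "i < l" "x = es ! (Suc i mod l)" | "x \<notin> set cs \<union> set ds"
    proof -
      have "\<exists>i<l. es ! j = es ! (Suc i mod l)" if "j < l" for j
      proof (cases j)
        case 0
        then show ?thesis using that by (intro exI[of _ "l - 1"]) simp
      next
        case (Suc k)
        then show ?thesis using that by (intro exI[of _ k]) simp
      qed
      then have "\<exists>i<l. x = es ! (Suc i mod l)" if "x \<in> set ds"
        using that les unfolding les(2)[symmetric] in_set_conv_nth by auto
      moreover have "\<exists>i<l. x = cs ! i" if "x \<in> set cs"
        using that assms(2) unfolding in_set_conv_nth by auto
      ultimately show thesis using that by blast
    qed
    then show ?thesis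
    proof cases
      case 3
      then have "x \<notin> pts (map fst ts)" "x \<notin> pts (map snd ts)" "x \<notin> pts [cs, ds]" using pts by auto
      then show ?thesis by (simp add: prodc_notin del: set_concat prodc.simps)
    qed (simp_all add: cds dds inv del: prodc.simps)
  qed
  then have "fac [cs, ds] ts"
    unfolding fac_def pts using d assms les
    by (auto simp: fst snd distinct_concat_pairs fun_eq_iff simp del: prodc.simps)
      (auto simp: ts_def)
  moreover have "sizes ts = replicate l (2, 2)"
    by (rule nth_equalityI) (use assms les in \<open>auto simp: ts_def\<close>)
  ultimately show thesis using that by blast
qed

text \<open>An explicit identity, checked at the eight points. Taking the transpositions two at a
  time gives two pairs of 3-cycles instead; the excesses of the two factorizations are
  consecutive.\<close>

lemma fac_four_transpositions:
  assumes "distinct [x0, x1, x2, x3, x4, x5, x6, x7]"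
  shows "fac [[x0, x1], [x2, x3], [x4, x5], [x6, x7]]
    [([x0, x3, x4, x1, x6], [x1, x6, x5, x3, x7]), ([x2, x5, x7], [x0, x4, x2])]"
proof -
  have rev: "distinct [x7, x6, x5, x4, x3, x2, x1, x0]"
    using assms distinct_rev[of "[x0, x1, x2, x3, x4, x5, x6, x7]"] by (simp only: rev.simps append.simps)
  define g where "g = [[x0, x1], [x2, x3], [x4, x5], [x6, x7]]"
  have g: "prodc g x0 = x1" "prodc g x1 = x0" "prodc g x2 = x3" "prodc g x3 = x2" "prodc g x4 = x5" "prodc g x5 = x4" "prodc g x6 = x7" "prodc g x7 = x6"
    using assms rev prodc_in[of g "[x0, x1]"] prodc_in[of g "[x2, x3]"] prodc_in[of g "[x4, x5]"] prodc_in[of g "[x6, x7]"]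
      cyc_nth[of "[x0, x1]" 0] cyc_nth[of "[x0, x1]" 1] cyc_nth[of "[x2, x3]" 0] cyc_nth[of "[x2, x3]" 1] cyc_nth[of "[x4, x5]" 0] cyc_nth[of "[x4, x5]" 1] cyc_nth[of "[x6, x7]" 0] cyc_nth[of "[x6, x7]" 1]
    by (simp_all add: g_def del: cycle_of_list.simps prodc.simps)
  define a where "a = [[x0, x3, x4, x1, x6], [x2, x5, x7]]"
  have a: "prodc a x0 = x3" "prodc a x3 = x4" "prodc a x4 = x1" "prodc a x1 = x6" "prodc a x6 = x0" "prodc a x2 = x5" "prodc a x5 = x7" "prodc a x7 = x2"
    using assms rev prodc_in[of a "[x0, x3, x4, x1, x6]"] prodc_in[of a "[x2, x5, x7]"]
      cyc_nth[of "[x0, x3, x4, x1, x6]" 0] cyc_nth[of "[x0, x3, x4, x1, x6]" 1] cyc_nth[of "[x0, x3, x4, x1, x6]" 2] cyc_nth[of "[x0, x3, x4, x1, x6]" 3] cyc_nth[of "[x0, x3, x4, x1, x6]" 4] cyc_nth[of "[x2, x5, x7]" 0] cyc_nth[of "[x2, x5, x7]" 1] cyc_nth[of "[x2, x5, x7]" 2]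
    by (simp_all add: a_def del: cycle_of_list.simps prodc.simps)
  define b where "b = [[x1, x6, x5, x3, x7], [x0, x4, x2]]"
  have b: "prodc b x1 = x6" "prodc b x6 = x5" "prodc b x5 = x3" "prodc b x3 = x7" "prodc b x7 = x1" "prodc b x0 = x4" "prodc b x4 = x2" "prodc b x2 = x0"
    using assms rev prodc_in[of b "[x1, x6, x5, x3, x7]"] prodc_in[of b "[x0, x4, x2]"]
      cyc_nth[of "[x1, x6, x5, x3, x7]" 0] cyc_nth[of "[x1, x6, x5, x3, x7]" 1] cyc_nth[of "[x1, x6, x5, x3, x7]" 2] cyc_nth[of "[x1, x6, x5, x3, x7]" 3] cyc_nth[of "[x1, x6, x5, x3, x7]" 4] cyc_nth[of "[x0, x4, x2]" 0] cyc_nth[of "[x0, x4, x2]" 1] cyc_nth[of "[x0, x4, x2]" 2]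
    by (simp_all add: b_def del: cycle_of_list.simps prodc.simps)
  have "prodc g x = (prodc a \<circ> prodc b) x" for x
  proof (cases "x \<in> {x0, x1, x2, x3, x4, x5, x6, x7}")
    case True
    then show ?thesis by (auto simp: g a b)
  next
    case False
    then have "x \<notin> pts g" "x \<notin> pts a" "x \<notin> pts b" by (auto simp: g_def a_def b_def)
    then show ?thesis by (simp add: prodc_notin del: set_concat)
  qed
  then have "prodc g = prodc a \<circ> prodc b" by blast
  then show ?thesis using assms rev unfolding fac_def g_def a_def b_def by (auto simp del: prodc.simps)
qed

section \<open>Factorizations depending only on the cycle type\<close>

text \<open>All arrangements of disjoint cycles with lengths \<open>M\<close> are covered at once,
  so such statements can be added over multisets. The points are natural numbers as in
  \<open>alt_group\<close>.\<close>

definition realizes :: "nat multiset \<Rightarrow> ((nat \<times> nat) multiset \<Rightarrow> bool) \<Rightarrow> bool" where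
  "realizes M P \<longleftrightarrow> (\<forall>css::nat list list. distinct (concat css) \<longrightarrow> mset (map length css) = M \<longrightarrow>
     (\<exists>ts. fac css ts \<and> P (mset (sizes ts))))"

lemma realizesI:
  assumes "\<And>css::nat list list. distinct (concat css) \<Longrightarrow> mset (map length css) = M \<Longrightarrow>
     \<exists>ts. fac css ts \<and> P (mset (sizes ts))"
  shows "realizes M P"
  using assms unfolding realizes_def by blast

lemma realizes_mono: "realizes M P \<Longrightarrow> (\<And>S. P S \<Longrightarrow> Q S) \<Longrightarrow> realizes M Q"
  unfolding realizes_def by blast

lemma realizes_add:
  assumes "realizes M P" "realizes N Q" "\<And>S T. P S \<Longrightarrow> Q T \<Longrightarrow> R (S + T)"
  shows "realizes (M + N) R"
proof (rule realizesI)
  fix css :: "nat list list"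
  assume css: "distinct (concat css)" "mset (map length css) = M + N"
  then obtain A B where AB: "mset css = A + B" "M = image_mset length A" "N = image_mset length B"
    by (metis image_mset_eq_plusD mset_map)
  obtain as bs where ab: "mset as = A" "mset bs = B" by (metis ex_mset)
  have m: "mset css = mset (as @ bs)" using AB ab by simp
  have d: "distinct (concat (as @ bs))" by (rule distinct_concat_mset[OF m css(1)])
  have "distinct (concat as)" "distinct (concat bs)" "mset (map length as) = M" "mset (map length bs) = N"
    using d ab AB by simp_all
  then obtain ts us where "fac as ts" "P (mset (sizes ts))" "fac bs us" "Q (mset (sizes us))"
    using assms(1,2) unfolding realizes_def by blast
  moreover from this have "fac (as @ bs) (ts @ us)" using d by (intro fac_union) auto
  then have "fac css (ts @ us)" by (rule fac_mset_cycles[OF _ m[symmetric] d])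
  ultimately show "\<exists>ts. fac css ts \<and> R (mset (sizes ts))"
    using assms(3) by (intro exI[of _ "ts @ us"]) simp
qed

abbreviation good :: "nat \<Rightarrow> nat multiset \<Rightarrow> bool" where
  "good p M \<equiv> realizes M (\<lambda>S. \<forall>(i, j)\<in>#S. i \<in> {1, p} \<and> j \<in> {1, p})"

abbreviation balanced :: "nat multiset \<Rightarrow> nat multiset \<Rightarrow> bool" where
  "balanced M T \<equiv> realizes M (\<lambda>S. S = image_mset (\<lambda>t. (t, t)) T)"

lemma good_add: "good p M \<Longrightarrow> good p N \<Longrightarrow> good p (M + N)"
  by (erule realizes_add, assumption) auto

lemma balanced_add: "balanced M S \<Longrightarrow> balanced N T \<Longrightarrow> balanced (M + N) (S + T)"
  by (erule realizes_add, assumption) auto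

lemma good_empty: "good p {#}"
  by (intro realizesI exI[of _ "[]"]) (auto simp: fac_def)

lemma balanced_empty: "balanced {#} {#}"
  by (intro realizesI exI[of _ "[]"]) (auto simp: fac_def)

lemma balanced_imp_good:
  assumes "balanced M (replicate_mset k p)" shows "good p M"
  using assms by (rule realizes_mono) auto

lemma balanced_merge2:
  assumes "balanced M (add_mset s (add_mset t T))" shows "balanced M (add_mset (s + t) T)"
proof (rule realizesI)
  fix css :: "nat list list"
  assume "distinct (concat css)" "mset (map length css) = M"
  then obtain ts where ts: "fac css ts"
    "mset (sizes ts) = image_mset (\<lambda>t. (t, t)) (add_mset s (add_mset t T))"
    using assms unfolding realizes_def by blast
  then have "image_mset (\<lambda>t. (length (fst t), length (snd t))) (mset ts) =
      add_mset (s, s) (add_mset (t, t) (image_mset (\<lambda>t. (t, t)) T))" by simp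
  from msed_map_invR[OF this] obtain R1 u where u: "mset ts = add_mset u R1" "(length (fst u), length (snd u)) = (s, s)"
    "image_mset (\<lambda>t. (length (fst t), length (snd t))) R1 = add_mset (t, t) (image_mset (\<lambda>t. (t, t)) T)" by blast
  from msed_map_invR[OF u(3)] obtain R v where R: "mset ts = add_mset u (add_mset v R)"
    "(length (fst v), length (snd v)) = (t, t)"
    "image_mset (\<lambda>t. (length (fst t), length (snd t))) R = image_mset (\<lambda>t. (t, t)) T" using u(1) by blast
  obtain rs where rs: "mset rs = R" by (metis ex_mset)
  have "fac css (u # v # rs)" by (rule fac_mset_tokens[OF ts(1)]) (simp add: R rs)
  then obtain C D where "fac css ((C, D) # rs)" "length C = length (fst u) + length (fst v)"
    "length D = length (snd u) + length (snd v)" by (rule fac_merge)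
  then show "\<exists>ts. fac css ts \<and> mset (sizes ts) = image_mset (\<lambda>t. (t, t)) (add_mset (s + t) T)"
    using R u(2) rs by (intro exI[of _ "(C, D) # rs"]) simp
qed

lemma balanced_merge:
  assumes "balanced M (S + T)" "S \<noteq> {#}" shows "balanced M (add_mset (sum_mset S) T)"
  using assms
proof (induction "size S" arbitrary: S)
  case (Suc n)
  show ?case
  proof (cases "n = 0")
    case True
    then obtain s where "S = {#s#}" using Suc.hyps(2) size_1_singleton_mset by auto
    then show ?thesis using Suc.prems by simp
  next
    case False
    obtain s S' where s: "S = add_mset s S'" using Suc.prems(2) by (meson multiset_cases)
    then obtain t S'' where t: "S' = add_mset t S''" using Suc.hyps(2) False by (metis multiset_cases size_add_mset size_empty nat.inject)
    have "balanced M (add_mset (s + t) (S'' + T))"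
      by (rule balanced_merge2) (use Suc.prems s t in \<open>simp add: add.commute\<close>)
    then show ?thesis using Suc.hyps(1)[of "add_mset (s + t) S''"] Suc.hyps(2) by (simp add: s t add.assoc)
  qed
qed simp

section \<open>The elementary factorizations in terms of cycle types\<close>

lemma realizes_1:
  assumes "\<And>cs::nat list. distinct cs \<Longrightarrow> length cs = l \<Longrightarrow> \<exists>ts. fac [cs] ts \<and> P (mset (sizes ts))"
  shows "realizes {#l#} P"
proof (rule realizesI)
  fix css :: "nat list list" assume css: "distinct (concat css)" "mset (map length css) = {#l#}"
  then have "size (mset (map length css)) = 1" by simp
  then have "length css = Suc 0" by simp
  then obtain cs where "css = [cs]" by (metis length_0_conv length_Suc_conv)
  moreover from this have "length cs = l" using css(2) by simp
  ultimately have "css = [cs]" "length cs = l" by blast+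
  then show "\<exists>ts. fac css ts \<and> P (mset (sizes ts))" using assms css by auto
qed

lemma realizes_2:
  assumes "\<And>cs ds::nat list. distinct (cs @ ds) \<Longrightarrow> length cs = l \<Longrightarrow> length ds = m \<Longrightarrow>
    \<exists>ts. fac [cs, ds] ts \<and> P (mset (sizes ts))"
  shows "realizes {#l, m#} P"
proof (rule realizesI)
  fix css :: "nat list list" assume css: "distinct (concat css)" "mset (map length css) = {#l, m#}"
  then have "image_mset length (mset css) = add_mset l {#m#}" by simp
  from msed_map_invR[OF this] obtain A cs where A: "mset css = add_mset cs A" "length cs = l"
    "image_mset length A = add_mset m {#}" by blast
  from msed_map_invR[OF A(3)] obtain ds where c: "mset css = {#cs, ds#}" "length cs = l" "length ds = m"
    using A by auto
  then have m: "mset css = mset [cs, ds]" by simp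
  note d = distinct_concat_mset[OF m css(1)]
  then obtain ts where "fac [cs, ds] ts" "P (mset (sizes ts))" using assms[of cs ds] c by auto
  then show "\<exists>ts. fac css ts \<and> P (mset (sizes ts))" using fac_mset_cycles[OF _ m[symmetric] d] by blast
qed

text \<open>A fixed point counts as a pair of trivial cycles, available for lengthening another pair
  by one.\<close>

lemma balanced_1: "balanced {#1#} {#1#}"
proof (rule realizes_1)
  fix cs :: "nat list" assume "length cs = 1"
  then show "\<exists>ts. fac [cs] ts \<and> mset (sizes ts) = image_mset (\<lambda>t. (t, t)) {#1#}"
    by (intro exI[of _ "[(cs, cs)]"]) (auto simp: fac_def length_Suc_conv)
qed

lemma balanced_chain:
  assumes "\<forall>x\<in>set xs. 0 < x"
  shows "balanced {#2 * sum_list xs + 1#} (image_mset Suc (mset xs))"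
proof (rule realizes_1)
  fix cs :: "nat list"
  assume "distinct cs" "length cs = 2 * sum_list xs + 1"
  then obtain ts where "fac [cs] ts" "sizes ts = stars xs"
    using ex_fac_chain[OF assms, where 'a=nat] by blast
  then show "\<exists>ts. fac [cs] ts \<and> mset (sizes ts) = image_mset (\<lambda>t. (t, t)) (image_mset Suc (mset xs))"
    by (intro exI[of _ ts]) (simp add: multiset.map_comp comp_def)
qed

lemma balanced_even_pair:
  assumes "\<forall>x\<in>set xs. 0 < x" "\<forall>x\<in>set ys. 0 < x"
  shows "balanced {#2 * sum_list xs + 2, 2 * sum_list ys + 2#} (add_mset 3 (image_mset Suc (mset (xs @ ys))))"
proof (rule realizes_2)
  fix cs ds :: "nat list"
  assume "distinct (cs @ ds)" "length cs = 2 * sum_list xs + 2" "length ds = 2 * sum_list ys + 2"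
  then obtain t ts us where "fac [cs, ds] (t # ts @ us)" "sizes [t] = [(3, 3)]" "sizes ts = stars xs" "sizes us = stars ys"
    by (rule ex_fac_even_pair[OF assms])
  then show "\<exists>ts. fac [cs, ds] ts \<and> mset (sizes ts) =
      image_mset (\<lambda>t. (t, t)) (add_mset 3 (image_mset Suc (mset (xs @ ys))))"
    by (intro exI[of _ "t # ts @ us"])
      (simp only: list.map map_append mset_append mset.simps, simp add: multiset.map_comp comp_def)
qed

lemma balanced_filled_pair:
  assumes "\<forall>x\<in>set xs. 0 < x" "\<forall>x\<in>set ys. 0 < x"
  shows "balanced {#2 * sum_list xs + 4, 2 * sum_list ys + 4#}
    (add_mset 3 (add_mset 5 (image_mset Suc (mset (xs @ ys)))))"
proof (rule realizes_2)
  fix cs ds :: "nat list"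
  assume "distinct (cs @ ds)" "length cs = 2 * sum_list xs + 4" "length ds = 2 * sum_list ys + 4"
  then obtain ts where "fac [cs, ds] ts" "mset (sizes ts) = mset ((3, 3) # (5, 5) # stars xs @ stars ys)"
    by (rule ex_fac_filled_pair[OF assms])
  then show "\<exists>ts. fac [cs, ds] ts \<and> mset (sizes ts) =
      image_mset (\<lambda>t. (t, t)) (add_mset 3 (add_mset 5 (image_mset Suc (mset (xs @ ys)))))"
    by (intro exI[of _ ts]) (simp add: multiset.map_comp comp_def)
qed

lemma balanced_odd_full:
  assumes "\<forall>x\<in>set xs. 0 < x"
  shows "balanced {#2 * sum_list xs + 3#} (add_mset 3 (image_mset Suc (mset xs)))"
proof (rule realizes_1)
  fix cs :: "nat list"
  assume "distinct cs" "length cs = 2 * sum_list xs + 3"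
  then obtain ts where "fac [cs] ts" "sizes ts = (3, 3) # stars xs"
    by (rule ex_fac_odd_full[OF assms])
  then show "\<exists>ts. fac [cs] ts \<and> mset (sizes ts) = image_mset (\<lambda>t. (t, t)) (add_mset 3 (image_mset Suc (mset xs)))"
    by (intro exI[of _ ts]) (simp add: multiset.map_comp comp_def)
qed

lemma balanced_equal_pair: "balanced {#l, l#} (replicate_mset l 2)"
proof (rule realizes_2)
  fix cs ds :: "nat list"
  assume "distinct (cs @ ds)" "length cs = l" "length ds = l"
  then obtain ts where "fac [cs, ds] ts" "sizes ts = replicate l (2, 2)" by (rule ex_fac_equal_pair)
  then show "\<exists>ts. fac [cs, ds] ts \<and> mset (sizes ts) = image_mset (\<lambda>t. (t, t)) (replicate_mset l 2)"
    by (intro exI[of _ ts]) simp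
qed

lemma balanced_four_2: "balanced {#2, 2, 2, 2#} {#3, 5#}"
proof (rule realizesI)
  fix css :: "nat list list"
  assume css: "distinct (concat css)" "mset (map length css) = {#2, 2, 2, 2#}"
  then have "size (mset (map length css)) = 4" "set_mset (mset (map length css)) = {2}" by simp_all
  then have "\<forall>c\<in>set css. length c = 2" "length css = 4" by auto
  then obtain c0 c1 c2 c3 where c: "css = [c0, c1, c2, c3]" by (auto simp: numeral_eq_Suc length_Suc_conv)
  have "length c0 = 2" "length c1 = 2" "length c2 = 2" "length c3 = 2"
    using \<open>\<forall>c\<in>set css. length c = 2\<close> by (auto simp: c)
  then obtain x0 x1 x2 x3 x4 x5 x6 x7 where "c0 = [x0, x1]" "c1 = [x2, x3]" "c2 = [x4, x5]" "c3 = [x6, x7]"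
    by (auto simp: numeral_eq_Suc length_Suc_conv)
  then show "\<exists>ts. fac css ts \<and> mset (sizes ts) = image_mset (\<lambda>t. (t, t)) {#3, 5#}"
    using fac_four_transpositions[of x0 x1 x2 x3 x4 x5 x6 x7] css(1)
    by (intro exI[of _ "[([x0, x3, x4, x1, x6], [x1, x6, x5, x3, x7]), ([x2, x5, x7], [x0, x4, x2])]"])
      (simp add: c add_mset_commute numeral_eq_Suc)
qed

section \<open>The excess of a cycle type\<close>

text \<open>For \<open>p = 2 * q - 1\<close> a cycle of length \<open>p\<close> is obtained by merging one 3-cycle and \<open>q - 2\<close> transpositions,
  or one 5-cycle and \<open>q - 3\<close> transpositions; the excess counts the surplus of transpositions.\<close>

definition excess :: "nat \<Rightarrow> nat multiset \<Rightarrow> int \<Rightarrow> bool" where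
  "excess q M e \<longleftrightarrow> (\<exists>a w b. balanced M (replicate_mset a 3 + replicate_mset w 5 + replicate_mset b 2) \<and>
     e = int b - (int q - 2) * int a - (int q - 3) * int w)"

lemma excessI:
  assumes "balanced M T" "T = replicate_mset a 3 + replicate_mset w 5 + replicate_mset b 2"
    "e = int b - (int q - 2) * int a - (int q - 3) * int w"
  shows "excess q M e"
  using assms unfolding excess_def by blast

lemma replicate_mset_add: "replicate_mset (m + n) x = replicate_mset m x + replicate_mset n x"
  by (induction m) auto

lemma excess_add:
  assumes "excess q M e" "excess q N f" shows "excess q (M + N) (e + f)"
proof -
  obtain a w b where 1: "balanced M (replicate_mset a 3 + replicate_mset w 5 + replicate_mset b 2)"
    "e = int b - (int q - 2) * int a - (int q - 3) * int w" using assms(1) unfolding excess_def by blast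
  obtain a' w' b' where 2: "balanced N (replicate_mset a' 3 + replicate_mset w' 5 + replicate_mset b' 2)"
    "f = int b' - (int q - 2) * int a' - (int q - 3) * int w'" using assms(2) unfolding excess_def by blast
  show ?thesis
    by (rule excessI[OF balanced_add[OF 1(1) 2(1)], of "a + a'" "w + w'" "b + b'"])
      (simp_all add: 1 2 replicate_mset_add algebra_simps)
qed

lemma excess_empty: "excess q {#} 0"
  by (rule excessI[OF balanced_empty, of 0 0 0]) auto

lemma excess_repeat: "excess q M e \<Longrightarrow> excess q (repeat_mset n M) (int n * e)"
proof (induction n)
  case (Suc n)
  then show ?case using excess_add[of q M e "repeat_mset n M" "int n * e"] by (simp add: algebra_simps)
qed (simp add: excess_empty)

text \<open>Each pair of length \<open>s\<close> is merged with \<open>b\<close> pairs of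
  transpositions of its own.\<close>

lemma balanced_pack:
  assumes "balanced M (replicate_mset a s + replicate_mset (a * b) 2 + T)" "s + 2 * b = p"
  shows "balanced M (replicate_mset a p + T)"
  using assms
proof (induction a arbitrary: T)
  case (Suc a)
  have "balanced M ((add_mset s (replicate_mset b 2)) + (replicate_mset a s + replicate_mset (a * b) 2 + T))"
    using Suc.prems by (simp add: replicate_mset_add ac_simps)
  from balanced_merge[OF this] Suc.prems(2)
  have "balanced M (replicate_mset a s + replicate_mset (a * b) 2 + (add_mset p T))"
    by (simp add: mult.commute)
  then show ?case using Suc.IH[of "add_mset p T"] Suc.prems(2) by simp
qed simp

text \<open>Excess 0 means \<open>b = a * (q - 2) + w * (q - 3)\<close>. The transpositions can then
  be shared out completely, as \<open>3 + 2 * (q - 2) = 5 + 2 * (q - 3) = 2 * q - 1\<close>.\<close>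

lemma excess_0_good:
  assumes "excess q M 0" "3 \<le> q" shows "good (2 * q - 1) M"
proof -
  obtain a w b where 1: "balanced M (replicate_mset a 3 + replicate_mset w 5 + replicate_mset b 2)"
    "0 = int b - (int q - 2) * int a - (int q - 3) * int w" using assms(1) unfolding excess_def by blast
  obtain q' where q: "q = q' + 3" using assms(2) by (metis add.commute le_Suc_ex)
  have "int b = int (a * (q' + 1) + w * q')" using 1(2) by (simp add: q algebra_simps)
  then have "b = a * (q' + 1) + w * q'" by (simp only: of_nat_eq_iff)
  then have b: "b = a * (q - 2) + w * (q - 3)" by (simp add: q)
  have "balanced M (replicate_mset a 3 + replicate_mset (a * (q - 2)) 2 +
      (replicate_mset w 5 + replicate_mset (w * (q - 3)) 2))"
    using 1(1) by (simp add: b replicate_mset_add ac_simps)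
  from balanced_pack[OF this, of "2 * q - 1"] assms(2)
  have "balanced M (replicate_mset w 5 + replicate_mset (w * (q - 3)) 2 + replicate_mset a (2 * q - 1))"
    by (simp add: add.commute)
  from balanced_pack[OF this, of "2 * q - 1"] assms(2)
  have "balanced M (replicate_mset (w + a) (2 * q - 1))" by (simp add: replicate_mset_add)
  then show ?thesis by (rule balanced_imp_good)
qed

text \<open>Fixed points serve as fillers: a pair of length \<open>t\<close> becomes a pair of
  \<open>p\<close>-cycles by merging it with \<open>p - t\<close> trivial pairs. Surplus fixed
  points stay fixed.\<close>

lemma good_ones_add:
  assumes "balanced M T" "\<forall>t\<in>#T. t \<le> p" "p * size T \<le> k"
  shows "good p (M + replicate_mset k 1)"
proof -
  have one: "balanced (replicate_mset n 1) (replicate_mset n 1)" "good p (replicate_mset n 1)" for n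
  proof (induction n)
    case 0
    case 1 show ?case using balanced_empty by simp
    case 2 show ?case using good_empty[of p] by simp
  next
    case (Suc n)
    case 1 show ?case using balanced_add[OF balanced_1 Suc(1)] by simp
    case 2
    have "good p {#1#}" using balanced_1 by (rule realizes_mono) simp
    from good_add[OF this Suc(2)] show ?case by simp
  qed
  have *: "balanced N (replicate_mset (size T) p + S)"
    if "balanced N (T + replicate_mset (\<Sum>t\<in>#T. p - t) 1 + S)" "\<forall>t\<in>#T. t \<le> p" for N S
    using that
  proof (induction T arbitrary: S)
    case (add t T)
    have "balanced N ((add_mset t (replicate_mset (p - t) 1)) + (T + replicate_mset (\<Sum>t\<in>#T. p - t) 1 + S))"
      using add.prems(1) by (simp only: image_mset_add_mset sum_mset.add_mset replicate_mset_add
          union_mset_add_mset_left union_mset_add_mset_right ac_simps)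
    from balanced_merge[OF this] add.prems(2)
    have "balanced N (T + replicate_mset (\<Sum>t\<in>#T. p - t) 1 + add_mset p S)" by simp
    then show ?case using add.IH[of "add_mset p S"] add.prems(2) by simp
  qed simp
  have le: "(\<Sum>t\<in>#T. p - t) \<le> k"
  proof -
    have "(\<Sum>t\<in>#T. p - t) \<le> p * size T" by (induction T) auto
    then show ?thesis using assms(3) by simp
  qed
  have "balanced (M + replicate_mset (\<Sum>t\<in>#T. p - t) 1) (replicate_mset (size T) p)"
    using *[of _ "{#}"] balanced_add[OF assms(1) one(1)] assms(2) by simp
  from good_add[OF balanced_imp_good[OF this] one(2)[of "k - (\<Sum>t\<in>#T. p - t)"]]
  show ?thesis using le by (simp add: add.assoc flip: replicate_mset_add)
qed

section \<open>Excesses of one odd cycle and of two even cycles\<close>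

text \<open>In a chain the parts 1, 2 and 4 become pairs of lengths 2, 3 and 5. Replacing two parts
  1 by a part 2 lowers the excess by \<open>q\<close>, and replacing four parts 1 by a part 4 lowers
  it by \<open>q + 1\<close>.\<close>

abbreviation parts :: "nat \<Rightarrow> nat \<Rightarrow> nat \<Rightarrow> nat list" where
  "parts n i j \<equiv> replicate i 2 @ replicate j 4 @ replicate (n - 2 * i - 4 * j) 1"

lemma parts:
  assumes "2 * i + 4 * j \<le> n"
  shows "\<forall>x\<in>set (parts n i j). 0 < x" "sum_list (parts n i j) = n"
    "image_mset Suc (mset (parts n i j)) =
      replicate_mset i 3 + replicate_mset j 5 + replicate_mset (n - 2 * i - 4 * j) 2"
  using assms by (auto simp: sum_list_replicate numeral_eq_Suc)

lemma excess_odd: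
  assumes "2 * i + 4 * j \<le> n"
  shows "excess q {#2 * n + 1#} (int n - int q * int i - (int q + 1) * int j)"
  by (rule excessI[OF balanced_chain[OF parts(1)[OF assms], unfolded parts(2)[OF assms]], of i j "n - 2 * i - 4 * j"])
    (use assms in \<open>simp_all only: parts(3)[OF assms], simp add: of_nat_diff algebra_simps\<close>)

lemma excess_odd_full:
  assumes "2 * i \<le> n"
  shows "excess q {#2 * n + 3#} (int n - (int q - 2) - int q * int i)"
proof -
  have *: "2 * i + 4 * 0 \<le> n" using assms by simp
  show ?thesis
    by (rule excessI[OF balanced_odd_full[OF parts(1)[OF *], unfolded parts(2)[OF *]], of "Suc i" 0 "n - 2 * i - 4 * 0"])
      (use assms in \<open>simp_all only: parts(3)[OF *], simp_all add: of_nat_diff algebra_simps\<close>)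
qed

lemma excess_even:
  assumes "2 * i + 4 * j \<le> n" "2 * i' \<le> n'"
  shows "excess q {#2 * n + 2, 2 * n' + 2#}
    (int n + int n' - (int q - 2) - int q * int (i + i') - (int q + 1) * int j)"
proof -
  have *: "2 * i' + 4 * 0 \<le> n'" using assms by simp
  show ?thesis
    by (rule excessI[OF balanced_even_pair[OF parts(1)[OF assms(1)] parts(1)[OF *],
            unfolded parts(2)[OF assms(1)] parts(2)[OF *] mset_append[of "parts n i j"] image_mset_union
              parts(3)[OF assms(1)] parts(3)[OF *]],
          of "Suc (i + i')" j "(n - 2 * i - 4 * j) + (n' - 2 * i' - 4 * 0)"])
      (simp add: replicate_mset_add ac_simps, use assms in \<open>simp add: of_nat_diff algebra_simps\<close>)
qed

lemma excess_even_filled: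
  assumes "2 * i \<le> n" "2 * i' \<le> n'"
  shows "excess q {#2 * n + 4, 2 * n' + 4#}
    (int n + int n' - (int q - 2) - (int q - 3) - int q * int (i + i'))"
proof -
  have *: "2 * i + 4 * 0 \<le> n" "2 * i' + 4 * 0 \<le> n'" using assms by simp_all
  show ?thesis
    by (rule excessI[OF balanced_filled_pair[OF parts(1)[OF *(1)] parts(1)[OF *(2)],
            unfolded parts(2)[OF *(1)] parts(2)[OF *(2)] mset_append[of "parts n i 0"] image_mset_union
              parts(3)[OF *(1)] parts(3)[OF *(2)]],
          of "Suc (i + i')" 1 "(n - 2 * i - 4 * 0) + (n' - 2 * i' - 4 * 0)"])
      (simp add: replicate_mset_add ac_simps, use assms in \<open>simp add: of_nat_diff algebra_simps\<close>)
qed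

lemma excess_equal: "excess q {#l, l#} (int l)"
  by (rule excessI[OF balanced_equal_pair, of _ 0 0 l]) auto

lemma excess_four_2: "excess q {#2, 2, 2, 2#} (5 - 2 * int q)"
  by (rule excessI[OF balanced_four_2, of 1 1 0]) auto

text \<open>Repeating these multisets reaches every excess: each admits a positive, a negative and two consecutive excesses.\<close>

definition unit :: "nat \<Rightarrow> nat multiset" where
  "unit l = (if l = 1 then {#1#} else if l = 3 then {#3, 3#} else if odd l then {#l#} else {#l, l, l, l#})"

text \<open>The positive excess comes from factorizations into transpositions only, the negative one
  from factorizations without transpositions.\<close>

lemma ex_unit_excesses:
  assumes "2 \<le> l" "3 \<le> q"
  obtains a b e where "0 < a" "b < 0" "excess q (unit l) a" "excess q (unit l) b"
    "excess q (unit l) e" "excess q (unit l) (e + 1)"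
proof -
  consider "l = 3" | "l = 2" | X where "l = 2 * X + 1" "2 \<le> X" | k where "l = 2 * k" "2 \<le> k"
  proof (cases "even l")
    case True
    then obtain k where "l = 2 * k" by blast
    then show thesis using that assms(1) by (cases "k = 1") auto
  next
    case False
    then obtain X where "l = 2 * X + 1" by (blast elim: oddE)
    then show thesis using that assms(1) by (cases "X = 1") auto
  qed
  then show thesis
  proof cases
    case 1
    have "excess q {#3#} 1" "excess q {#3#} (2 - int q)"
      using excess_odd[of 0 0 1 q] excess_odd_full[of 0 0 q] by simp_all
    \<comment> \<open>The consecutive excesses are \<open>1 + 1\<close>, from the two cycles
      separately, and 3, from the equal pair.\<close>
    from excess_add[OF this(1) this(1)] excess_add[OF this(2) this(2)] excess_equal[of q 3]
    show thesis using that[of 3 "4 - 2 * int q" 2] assms(2) 1 by (simp add: unit_def add_mset_commute)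
  next
    case 2
    have "excess q {#2, 2#} 2" "excess q {#2, 2#} (2 - int q)"
      using excess_equal[of q 2] excess_even[of 0 0 0 0 0 q] by (simp_all add: numeral_2_eq_2)
    \<comment> \<open>The consecutive excesses are \<open>4 - 2 * q\<close>, from two pairs of
      transpositions, and \<open>5 - 2 * q\<close>, from all four together.\<close>
    from excess_add[OF this(1) this(1)] excess_add[OF this(2) this(2)] excess_four_2[of q]
    show thesis using that[of 4 "4 - 2 * int q" "4 - 2 * int q"] assms(2) 2 by (simp add: unit_def)
  next
    case 3
    have u: "unit l = {#2 * X + 1#}" using 3 by (auto simp: unit_def)
    have e: "excess q (unit l) (int X)" "excess q (unit l) (int X - int q)"
      using excess_odd[of 0 0 X q] excess_odd[of 1 0 X q] 3(2) by (simp_all add: u)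
    \<comment> \<open>Obtaining the 3-cycles from \<open>balanced_odd_full\<close> instead of from a
      part 2 leaves one more pair of transpositions.\<close>
    have f: "excess q (unit l) (int X - int q + 1)"
    proof -
      have "2 * (X - 1) + 3 = 2 * X + 1" using 3(2) by simp
      then show ?thesis using excess_odd_full[of 0 "X - 1" q] 3(2) by (simp add: u of_nat_diff algebra_simps)
    qed
    obtain b where "excess q (unit l) b" "b < 0"
    proof (cases "even X")
      case True
      then obtain i where i: "X = 2 * i" by blast
      have "excess q (unit l) (int X - int q * int i)" using excess_odd[of i 0 X q] by (simp add: u i)
      moreover have "3 * int i \<le> int q * int i" using assms(2) by (intro mult_right_mono) auto
      then have "int X - int q * int i < 0" using 3(2) i by simp
      ultimately show thesis using that by blast
    next
      case False
      then obtain i where i: "X = 2 * i + 1" by (blast elim: oddE)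
      have "excess q (unit l) (int (2 * i) - (int q - 2) - int q * int i)"
        using excess_odd_full[of i "2 * i" q] by (simp add: u i numeral_eq_Suc)
      moreover have "3 * int i \<le> int q * int i" using assms(2) by (intro mult_right_mono) auto
      then have "int (2 * i) - (int q - 2) - int q * int i < 0" using 3(2) i assms(2) by linarith
      ultimately show thesis using that by blast
    qed
    then show thesis using that[of "int X" b "int X - int q"] e f 3(2) by simp
  next
    case 4
    have u: "unit l = {#2 * k, 2 * k#} + {#2 * k, 2 * k#}" using 4 by (auto simp: unit_def)
    have k: "2 * (k - 1) + 2 = 2 * k" "2 * (k - 2) + 4 = 2 * k" using 4(2) by simp_all
    have e: "excess q {#2 * k, 2 * k#} (2 * int k)" using excess_equal[of q "2 * k"] by simp
    have f: "excess q {#2 * k, 2 * k#} (2 * int k - int q)"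
      using excess_even[of 0 0 "k - 1" 0 "k - 1" q, unfolded k] 4(2) by (simp add: of_nat_diff algebra_simps)
    have g: "excess q {#2 * k, 2 * k#} (2 * int k + 1 - 2 * int q)"
      using excess_even_filled[of 0 "k - 2" 0 "k - 2" q, unfolded k] 4(2) by (simp add: of_nat_diff algebra_simps)
    obtain b where "excess q {#2 * k, 2 * k#} b" "b < 0"
    proof (cases "even k")
      case True
      then obtain i where i: "k = 2 * i + 2"
      proof -
        have "k = 2 * (k div 2 - 1) + 2" using True 4(2) by presburger
        then show thesis using that by blast
      qed
      have ex: "excess q {#2 * k, 2 * k#} (int (2 * i) + int (2 * i) - (int q - 2) - (int q - 3) - int q * int (i + i))"
      proof -
        have "2 * (2 * i) + 4 = 2 * k" by (simp add: i)
        from excess_even_filled[of i "2 * i" i "2 * i" q, unfolded this] show ?thesis by simp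
      qed
      have "3 * int i \<le> int q * int i" using assms(2) by (intro mult_right_mono) auto
      moreover have "int q * int (i + i) = 2 * (int q * int i)" by (simp add: algebra_simps)
      ultimately have "int (2 * i) + int (2 * i) - (int q - 2) - (int q - 3) - int q * int (i + i) < 0"
        using assms(2) by linarith
      then show thesis using that ex by blast
    next
      case False
      then obtain i where i: "k = 2 * i + 1" by (blast elim: oddE)
      have ex: "excess q {#2 * k, 2 * k#} (int (2 * i) + int (2 * i) - (int q - 2) - int q * int (i + i))"
      proof -
        have "2 * (2 * i) + 2 = 2 * k" by (simp add: i)
        from excess_even[of i 0 "2 * i" i "2 * i" q, unfolded this] show ?thesis by simp
      qed
      have "3 * int i \<le> int q * int i" using assms(2) by (intro mult_right_mono) auto
      moreover have "int q * int (i + i) = 2 * (int q * int i)" by (simp add: algebra_simps)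
      moreover have "1 \<le> i" using 4(2) i by simp
      ultimately have "int (2 * i) + int (2 * i) - (int q - 2) - int q * int (i + i) < 0"
        using assms(2) by linarith
      then show thesis using that ex by blast
    qed
    \<comment> \<open>The two pairs of even cycles attain consecutive excesses in total:
      \<open>4 * k - 2 * q\<close> from \<open>f\<close> twice, and \<open>4 * k + 1 - 2 * q\<close>
      from \<open>e\<close> and \<open>g\<close>.\<close>
    then show thesis
      using that[of "2 * int k + 2 * int k" "b + b" "(2 * int k - int q) + (2 * int k - int q)"]
        excess_add[OF e e] excess_add[OF f f] excess_add[OF e g] excess_add[of q "{#2 * k, 2 * k#}" b "{#2 * k, 2 * k#}" b] 4(2)
      unfolding u by (simp add: algebra_simps)
  qed
qed

section \<open>Prescribing the excess of many equal units\<close>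

text \<open>With \<open>D = a - b\<close>, exchanging a summand \<open>a\<close> for
  \<open>b\<close> lowers the sum by \<open>D\<close>. This covers a long range of one residue class
  modulo \<open>D\<close>; the choice between \<open>e\<close> and \<open>e + 1\<close> in
  \<open>D\<close> further summands adjusts the residue.\<close>

lemma ex_excess_combination:
  fixes a b e r :: int
  assumes "0 < a" "b < 0"
  obtains K where "\<And>k. K \<le> k \<Longrightarrow>
    \<exists>x y z w. x + y + z + w = k \<and> int x * a + int y * b + int z * e + int w * (e + 1) = r"
proof -
  define D where "D = a - b"
  have D: "0 < D" using assms by (simp add: D_def)
  define m where "m = nat D"
  have m: "int m = D" using D by (simp add: m_def)
  define N where "N = nat (\<bar>r\<bar> + \<bar>D * e\<bar> + D)"
  have N: "\<bar>r\<bar> + \<bar>D * e\<bar> + D \<le> int N" by (simp add: N_def)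
  show thesis
  proof (rule that[of "N + m"])
    fix k assume k: "N + m \<le> k"
    define n where "n = k - m"
    have n: "k = n + m" "int N \<le> int n" using k by (auto simp: n_def)
    \<comment> \<open>The amount by which \<open>n\<close> summands \<open>a\<close> and
      \<open>D\<close> summands \<open>e\<close> exceed the target \<open>r\<close>.\<close>
    define s where "s = int n * a + D * e - r"
    have na: "int n \<le> int n * a" using assms(1) by (simp add: mult_le_cancel_left1)
    have nb: "int n \<le> int n * (- b)" using assms(2) mult_left_mono[of 1 "- b" "int n"] by simp
    have "int n * D = int n * a + int n * (- b)" by (simp add: D_def algebra_simps)
    then have s: "s + D \<le> int n * D" using N n(2) na nb unfolding s_def by linarith
    have s0: "0 \<le> s" using N n(2) na D unfolding s_def by linarith
    \<comment> \<open>\<open>y\<close> is \<open>s / D\<close> rounded up. The overshoot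
      \<open>t < D\<close> is given back by replacing \<open>t\<close> summands \<open>e\<close>
      with \<open>e + 1\<close>.\<close>
    define y where "y = (s + D - 1) div D"
    define t where "t = y * D - s"
    have t: "0 \<le> t" "t < D"
      using D minus_mod_eq_div_mult[of "s + D - 1" D] pos_mod_bound[OF D, of "s + D - 1"] pos_mod_sign[OF D, of "s + D - 1"]
      unfolding t_def y_def by linarith+
    have y0: "0 \<le> y" using s0 D by (simp add: y_def pos_imp_zdiv_nonneg_iff)
    have "y * D \<le> int n * D" using t s unfolding t_def by linarith
    then have y: "y \<le> int n" using D by simp
    have "int n * a - y * D + D * e + t = r" unfolding t_def s_def by (simp add: algebra_simps)
    then have "(int n - y) * a + y * b + (D - t) * e + t * (e + 1) = r"
      by (simp add: D_def algebra_simps)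
    moreover obtain x' y' z' w' where n': "int n - y = int x'" "y = int y'" "D - t = int z'" "t = int w'"
      using y0 y t by (metis diff_ge_0_iff_ge less_imp_le zero_le_imp_eq_int)
    ultimately have "int x' * a + int y' * b + int z' * e + int w' * (e + 1) = r" by simp
    moreover have "int (x' + y' + z' + w') = int k" using n' m n(1) by simp
    then have "x' + y' + z' + w' = k" by (simp only: of_nat_eq_iff)
    ultimately show "\<exists>x y z w. x + y + z + w = k \<and> int x * a + int y * b + int z * e + int w * (e + 1) = r"
      by blast
  qed
qed

lemma excess_units:
  assumes "2 \<le> l" "3 \<le> q"
  obtains K where "\<And>k. K \<le> k \<Longrightarrow> excess q (repeat_mset k (unit l)) r"
proof -
  obtain a b e where ab: "0 < a" "b < 0" and ex: "excess q (unit l) a" "excess q (unit l) b"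
    "excess q (unit l) e" "excess q (unit l) (e + 1)"
    using ex_unit_excesses[OF assms] by metis
  obtain K where K: "\<And>k. K \<le> k \<Longrightarrow>
      \<exists>x y z w. x + y + z + w = k \<and> int x * a + int y * b + int z * e + int w * (e + 1) = r"
    using ex_excess_combination[OF ab, of e r] by metis
  show thesis
  proof (rule that[of K])
    fix k assume "K \<le> k"
    then obtain x y z w where k: "x + y + z + w = k" and r: "int x * a + int y * b + int z * e + int w * (e + 1) = r"
      using K by blast
    show "excess q (repeat_mset k (unit l)) r"
      using excess_add[OF excess_add[OF excess_add[OF excess_repeat[OF ex(1), of x] excess_repeat[OF ex(2), of y]]
            excess_repeat[OF ex(3), of z]] excess_repeat[OF ex(4), of w]]
      unfolding r repeat_mset_distrib[symmetric] k .
  qed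
qed

section \<open>Large even cycle types\<close>

text \<open>The cycle types of even permutations.\<close>

definition even_type :: "nat multiset \<Rightarrow> bool" where
  "even_type M \<longleftrightarrow> even (size {#l \<in># M. even l#})"

lemma even_type_add: "even_type (M + N) \<longleftrightarrow> (even_type M \<longleftrightarrow> even_type N)"
  by (simp add: even_type_def)

lemma even_type_empty [simp]: "even_type {#}"
  by (simp add: even_type_def)

lemma even_type_add_mset [simp]: "even_type (add_mset l M) \<longleftrightarrow> (even l \<longleftrightarrow> \<not> even_type M)"
  by (simp add: even_type_def)

lemma even_type_unit: "even_type (repeat_mset k (unit l))"
proof (induction k)
  case (Suc k)
  have "even_type (unit l)" by (auto simp: unit_def)
  then show ?case using Suc by (simp add: even_type_add)
qed simp

lemma even_type_partner:
  assumes "even_type M" "l \<in># M" "even l"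
  obtains m where "even m" "{#l, m#} \<subseteq># M"
proof -
  obtain M' where M: "M = add_mset l M'" using assms(2) by (meson multi_member_split)
  then have "odd (size {#l \<in># M'. even l#})" using assms(1,3) by (simp add: even_type_def)
  then have "{#l \<in># M'. even l#} \<noteq> {#}" by (metis even_zero size_empty)
  then obtain m where "m \<in># {#l \<in># M'. even l#}" by (meson multiset_nonemptyE)
  then show thesis using that[of m] M by auto
qed

text \<open>The induction scheme for even types: odd lengths are removed singly and even lengths in
  pairs.\<close>

lemma even_type_cases:
  assumes "even_type M"
  obtains "M = {#}" | l M' where "M = add_mset l M'" "odd l" "even_type M'"
    | l m M' where "M = add_mset l (add_mset m M')" "even l" "even m" "even_type M'"
proof (cases "M = {#}")
  case False
  then obtain l M' where M: "M = add_mset l M'" by (meson multiset_cases)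
  show thesis
  proof (cases "even l")
    case True
    obtain m where "even m" "{#l, m#} \<subseteq># M" using even_type_partner[OF assms _ True] M by auto
    then obtain N where "M = add_mset l (add_mset m N)" by (auto simp: subset_mset.le_iff_add)
    then show thesis using that(3) \<open>even m\<close> True assms by auto
  qed (use that(2) M assms in auto)
qed (use that in blast)

lemma even_pos_eq: "even l \<Longrightarrow> l \<noteq> 0 \<Longrightarrow> \<exists>n. l = 2 * n + 2" for l :: nat
  by (intro exI[of _ "l div 2 - 1"]) presburger

text \<open>With all parts equal to 1, odd cycles give only transpositions, and any two even cycles
  contribute one pair of 3-cycles besides. The bound on the number of pairs later controls the
  excess of a bounded remainder.\<close>

lemma ex_balanced_2_3:
  assumes "even_type M" "0 \<notin># M"
  shows "\<exists>a b. balanced M (replicate_mset a 3 + replicate_mset b 2) \<and> a + b \<le> sum_mset M"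
  using assms
proof (induction "size M" arbitrary: M rule: less_induct)
  case less
  show ?case
    using less.prems(1)
  proof (cases rule: even_type_cases)
    case 1
    then show ?thesis using balanced_empty by (intro exI[of _ 0]) simp
  next
    case (2 l M')
    then have "size M' < size M" "0 \<notin># M'" "even_type M'" using less.prems(2) by simp_all
    then obtain a b where ab: "balanced M' (replicate_mset a 3 + replicate_mset b 2)" "a + b \<le> sum_mset M'"
      using less.hyps by blast
    obtain X where X: "l = 2 * X + 1" using 2 by (blast elim: oddE)
    have "balanced {#l#} (replicate_mset X 2)"
      using balanced_chain[of "replicate X 1"] by (simp add: X sum_list_replicate numeral_2_eq_2)
    from balanced_add[OF this ab(1)] ab(2) show ?thesis
      by (intro exI[of _ a] exI[of _ "X + b"]) (simp add: 2 X replicate_mset_add ac_simps)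
  next
    case (3 l m M')
    then have "size M' < size M" "0 \<notin># M'" "even_type M'" using less.prems(2) by simp_all
    then obtain a b where ab: "balanced M' (replicate_mset a 3 + replicate_mset b 2)" "a + b \<le> sum_mset M'"
      using less.hyps by blast
    have nz: "l \<noteq> 0" "m \<noteq> 0" using 3(1) less.prems(2) by auto
    obtain X where X: "l = 2 * X + 2" using even_pos_eq[OF 3(2) nz(1)] ..
    obtain Y where Y: "m = 2 * Y + 2" using even_pos_eq[OF 3(3) nz(2)] ..
    note XY = X Y
    have "balanced {#l, m#} (add_mset 3 (replicate_mset (X + Y) 2))"
    proof -
      have ones: "image_mset Suc (mset (replicate X 1 @ replicate Y 1)) = replicate_mset (X + Y) 2"
        by (simp add: replicate_mset_add numeral_2_eq_2)
      have pos: "\<forall>x\<in>set (replicate n (1::nat)). 0 < x" and sum: "sum_list (replicate n (1::nat)) = n" for n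
        by (simp_all add: sum_list_replicate)
      show ?thesis using balanced_even_pair[OF pos pos, of X Y] unfolding ones sum XY .
    qed
    from balanced_add[OF this ab(1)] ab(2) show ?thesis
      by (intro exI[of _ "Suc a"] exI[of _ "X + Y + b"]) (simp add: 3 XY replicate_mset_add ac_simps)
  qed
qed

section \<open>Long cycles\<close>

text \<open>\<open>q\<close> and \<open>q + 1\<close> are coprime, and \<open>j = s mod q\<close>
  keeps the share of \<open>q + 1\<close> small. The inequality bounds \<open>2 * i + 4 * j\<close>,
  the space taken by the parts 2 and 4, by \<open>2 * s / 3 + 2 * q\<close>.\<close>

lemma ex_two_coins:
  fixes q s :: nat
  assumes "3 \<le> q" "q * q \<le> s"
  obtains i j where "s = q * i + (q + 1) * j" "6 * i + 12 * j \<le> 2 * s + 6 * q"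
proof -
  define d j where "d = s div q" and "j = s mod q"
  have s: "s = q * d + j" "j < q" using assms(1) by (simp_all add: d_def j_def)
  have "q \<le> d" using assms by (simp add: d_def less_eq_div_iff_mult_less_eq)
  then obtain i where i: "d = i + j" using s(2) by (metis add.commute le_Suc_ex less_imp_le order_trans)
  have "3 * d \<le> q * d" using assms(1) by (intro mult_right_mono) auto
  then have "3 * d \<le> s" using s(1) by linarith
  moreover have "6 * i + 12 * j = 2 * (3 * d) + 6 * j" by (simp add: i)
  ultimately have "6 * i + 12 * j \<le> 2 * s + 6 * q" using s(2) by linarith
  moreover have "s = q * i + (q + 1) * j" using s(1) i by (simp add: algebra_simps)
  ultimately show thesis using that by blast
qed

lemma excess_long_odd:
  assumes "3 \<le> q" "\<bar>e\<bar> \<le> int B" "2 * B + 6 * q + q * q + B \<le> X"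
  shows "excess q {#2 * X + 1#} e"
proof -
  have qq: "int (q * q) \<le> int X - e" using assms(2,3) by linarith
  then have "0 \<le> int X - e" by (rule order_trans[rotated]) simp
  then obtain s where s1: "int X - e = int s" by (metis zero_le_imp_eq_int)
  then have "q * q \<le> s" using qq by (simp only: of_nat_le_iff)
  note s = s1 this
  obtain i j where ij: "s = q * i + (q + 1) * j" "6 * i + 12 * j \<le> 2 * s + 6 * q"
    using ex_two_coins[OF assms(1) s(2)] by blast
  have "int (6 * i + 12 * j) \<le> int (2 * s + 6 * q)" using ij(2) by (simp only: of_nat_le_iff)
  then have "6 * int i + 12 * int j \<le> 2 * (int X - e) + 6 * int q" unfolding s(1) by simp
  moreover have "2 * int B + 6 * int q \<le> int X"
  proof -
    have "2 * B + 6 * q \<le> X" using assms(3) by (rule order_trans[rotated]) simp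
    then show ?thesis by simp
  qed
  moreover have "- e \<le> int B" using assms(2) by simp
  ultimately have "2 * int i + 4 * int j \<le> int X" by simp
  then have "2 * i + 4 * j \<le> X" by simp
  from excess_odd[OF this, of q]
  have "excess q {#2 * X + 1#} (int X - (int q * int i + (int q + 1) * int j))" by (simp add: algebra_simps)
  moreover have "int q * int i + (int q + 1) * int j = int X - e" unfolding s(1) ij(1) by (simp add: algebra_simps)
  ultimately show ?thesis by simp
qed

text \<open>Only the first cycle has to be long. In the second one, \<open>i' = n' div q\<close>
  parts 2 reduce its contribution to the excess to \<open>t < q\<close>, and the first cycle
  compensates for \<open>t\<close>.\<close>

lemma excess_long_even:
  assumes "3 \<le> q" "\<bar>e\<bar> \<le> int B" "2 * B + 8 * q + q * q + B \<le> n"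
  shows "excess q {#2 * n + 2, 2 * n' + 2#} e"
proof -
  define i' t where "i' = n' div q" and "t = n' mod q"
  have t: "n' = q * i' + t" "t < q" using assms(1) by (simp_all add: i'_def t_def)
  have "2 * i' \<le> q * i'" using assms(1) by (intro mult_right_mono) auto
  then have i': "2 * i' \<le> n'" using t by linarith
  have qq: "int (q * q) \<le> int n + int t - (int q - 2) - e" using assms(2,3) by linarith
  then have "0 \<le> int n + int t - (int q - 2) - e" by (rule order_trans[rotated]) simp
  then obtain s where s1: "int n + int t - (int q - 2) - e = int s" by (metis zero_le_imp_eq_int)
  then have "q * q \<le> s" using qq by (simp only: of_nat_le_iff)
  note s = s1 this
  obtain i j where ij: "s = q * i + (q + 1) * j" "6 * i + 12 * j \<le> 2 * s + 6 * q"
    using ex_two_coins[OF assms(1) s(2)] by blast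
  have "int (6 * i + 12 * j) \<le> int (2 * s + 6 * q)" using ij(2) by (simp only: of_nat_le_iff)
  then have "6 * int i + 12 * int j \<le> 2 * (int n + int t - (int q - 2) - e) + 6 * int q" unfolding s(1) by simp
  moreover have "2 * int B + 8 * int q \<le> int n"
  proof -
    have "2 * B + 8 * q \<le> n" using assms(3) by (rule order_trans[rotated]) simp
    then show ?thesis by simp
  qed
  moreover have "- e \<le> int B" "3 \<le> int q" "int t + 1 \<le> int q" using assms(1,2) t(2) by simp_all
  ultimately have "2 * int i + 4 * int j \<le> int n" by simp
  then have "2 * i + 4 * j \<le> n" by simp
  from excess_even[OF this i', of q]
  have "excess q {#2 * n + 2, 2 * n' + 2#}
      (int n + (int n' - int q * int i') - (int q - 2) - (int q * int i + (int q + 1) * int j))" by (simp add: algebra_simps)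
  moreover have "int q * int i + (int q + 1) * int j = int n + int t - (int q - 2) - e"
    unfolding s(1) ij(1) by (simp add: algebra_simps)
  moreover have "int n' - int q * int i' = int t" using t(1) by simp
  ultimately show ?thesis by simp
qed

text \<open>\<open>L\<close> consists of the long cycle, with an even partner if its length is even,
  so the rest is again an even type.\<close>

lemma excess_long:
  assumes "3 \<le> q"
  obtains \<Lambda> where "\<And>M l. even_type M \<Longrightarrow> 0 \<notin># M \<Longrightarrow> l \<in># M \<Longrightarrow> \<Lambda> \<le> l \<Longrightarrow>
    \<exists>L. L \<subseteq># M \<and> L \<noteq> {#} \<and> even_type (M - L) \<and> (\<forall>e. \<bar>e\<bar> \<le> int B \<longrightarrow> excess q L e)"
proof (rule that[of "2 * (2 * B + 8 * q + q * q + B) + 2"])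
  fix M l
  assume M: "even_type M" "0 \<notin># M" "l \<in># M" and l: "2 * (2 * B + 8 * q + q * q + B) + 2 \<le> l"
  show "\<exists>L. L \<subseteq># M \<and> L \<noteq> {#} \<and> even_type (M - L) \<and> (\<forall>e. \<bar>e\<bar> \<le> int B \<longrightarrow> excess q L e)"
  proof (cases "even l")
    case False
    then obtain X where X: "l = 2 * X + 1" by (blast elim: oddE)
    obtain M' where M': "M = add_mset l M'" using M(3) by (meson multi_member_split)
    have "excess q {#l#} e" if "\<bar>e\<bar> \<le> int B" for e
      unfolding X by (rule excess_long_odd[OF assms that]) (use l in \<open>simp add: X\<close>)
    then show ?thesis using M(1) False by (intro exI[of _ "{#l#}"]) (simp add: M')
  next
    case True
    obtain m where m: "even m" "{#l, m#} \<subseteq># M" using even_type_partner[OF M(1,3) True] by blast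
    obtain M' where M': "M = {#l, m#} + M'" using m(2) by (auto simp: subset_mset.le_iff_add)
    have nz: "l \<noteq> 0" "m \<noteq> 0" using M(2) by (auto simp: M')
    obtain n where nl: "l = 2 * n + 2" using even_pos_eq[OF True nz(1)] ..
    obtain n' where nm: "m = 2 * n' + 2" using even_pos_eq[OF m(1) nz(2)] ..
    note n = nl nm
    have "excess q {#l, m#} e" if "\<bar>e\<bar> \<le> int B" for e
      unfolding n by (rule excess_long_even[OF assms that]) (use l in \<open>simp add: n\<close>)
    then show ?thesis using M(1) True m(1) by (intro exI[of _ "{#l, m#}"]) (simp add: M')
  qed
qed

section \<open>Bounded remainders and their absorption\<close>

lemma sum_mset_le_counts:
  fixes M :: "nat multiset"
  assumes "\<forall>l\<in>#M. l < \<Lambda> \<and> count M l \<le> c l"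
  shows "sum_mset M \<le> \<Lambda> * sum c {..<\<Lambda>}"
proof -
  have "\<forall>l\<in>#M. l \<le> \<Lambda>" using assms by auto
  then have "sum_mset M \<le> \<Lambda> * size M" by (induction M) (auto intro: add_mono)
  also have "size M \<le> (\<Sum>l\<in>set_mset M. c l)"
    unfolding size_multiset_overloaded_eq using assms by (intro sum_mono) blast
  also have "\<dots> \<le> sum c {..<\<Lambda>}" using assms by (intro sum_mono2) auto
  finally show ?thesis by simp
qed

text \<open>\<open>unit l\<close> contains at most four copies of \<open>l\<close>.\<close>

lemma repeat_unit_subset:
  assumes "4 * k \<le> count M l" shows "repeat_mset k (unit l) \<subseteq># M"
  using assms by (auto simp: unit_def subseteq_mset_def)

text \<open>Nonempty good parts are removed as long as the rest stays an even type. When none is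
  left, no length reaches \<open>\<Lambda>\<close> and no length occurs often, so the sum is
  bounded.\<close>

lemma strip:
  assumes "3 \<le> q"
  obtains B where "\<And>M. even_type M \<Longrightarrow> 0 \<notin># M \<Longrightarrow>
    \<exists>G R. M = G + R \<and> good (2 * q - 1) G \<and> even_type R \<and> sum_mset R \<le> B"
proof -
  \<comment> \<open>Only excess 0 is wanted here, hence the bound 0.\<close>
  obtain \<Lambda> where \<Lambda>: "\<And>M l. even_type M \<Longrightarrow> 0 \<notin># M \<Longrightarrow> l \<in># M \<Longrightarrow> \<Lambda> \<le> l \<Longrightarrow>
    \<exists>L. L \<subseteq># M \<and> L \<noteq> {#} \<and> even_type (M - L) \<and> (\<forall>e. \<bar>e\<bar> \<le> int 0 \<longrightarrow> excess q L e)"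
    using excess_long[OF assms, of 0] by blast
  have ex: "\<exists>K>0. good (2 * q - 1) (repeat_mset K (unit l))" if "0 < l" for l
  proof (cases "l = 1")
    case True
    have "good (2 * q - 1) {#1#}" using balanced_1 by (rule realizes_mono) simp
    then show ?thesis using True by (intro exI[of _ 1]) (simp add: unit_def)
  next
    case False
    then have "2 \<le> l" using that by simp
    then have "\<exists>K. \<forall>k\<ge>K. excess q (repeat_mset k (unit l)) 0" using excess_units[OF _ assms] by metis
    \<comment> \<open>\<open>Suc K\<close> is positive, so that the part removed later is
      nonempty.\<close>
    then obtain K where "excess q (repeat_mset (Suc K) (unit l)) 0" using le_SucI by blast
    then show ?thesis using excess_0_good assms by blast
  qed
  have "\<forall>l. \<exists>K. 0 < l \<longrightarrow> 0 < K \<and> good (2 * q - 1) (repeat_mset K (unit l))" using ex by blast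
  from choice[OF this] obtain K where K: "\<And>l. 0 < l \<Longrightarrow> 0 < K l \<and> good (2 * q - 1) (repeat_mset (K l) (unit l))"
    by blast
  show thesis
  proof (rule that)
    fix M assume "even_type M" "0 \<notin># M"
    then show "\<exists>G R. M = G + R \<and> good (2 * q - 1) G \<and> even_type R \<and> sum_mset R \<le> \<Lambda> * (\<Sum>l<\<Lambda>. 4 * K l)"
    proof (induction "size M" arbitrary: M rule: less_induct)
      case less
      show ?case
      proof (cases "\<exists>L. L \<subseteq># M \<and> L \<noteq> {#} \<and> even_type (M - L) \<and> good (2 * q - 1) L")
        case True
        then obtain L where L: "L \<subseteq># M" "L \<noteq> {#}" "even_type (M - L)" "good (2 * q - 1) L" by blast
        have "size (M - L) < size M" using L(1,2)
          by (metis nonempty_has_size size_Diff_submset diff_less size_mset_mono less_le_trans)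
        moreover have "0 \<notin># M - L" using less.prems(2) by (meson in_diffD)
        ultimately obtain G R where GR: "M - L = G + R" "good (2 * q - 1) G" "even_type R"
          "sum_mset R \<le> \<Lambda> * (\<Sum>l<\<Lambda>. 4 * K l)" using less.hyps L(3) by blast
        have "M = L + G + R" using subset_mset.add_diff_inverse[OF L(1)] by (simp add: GR(1) add.assoc)
        then show ?thesis using good_add[OF L(4) GR(2)] GR(3,4) by blast
      next
        case False
        have "l < \<Lambda> \<and> count M l \<le> 4 * K l" if l: "l \<in># M" for l
        proof
          show "l < \<Lambda>"
          proof (rule ccontr)
            assume "\<not> l < \<Lambda>"
            then obtain L where "L \<subseteq># M" "L \<noteq> {#}" "even_type (M - L)" "excess q L 0"
              using \<Lambda>[OF less.prems l] by auto
            then show False using False excess_0_good assms by blast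
          qed
          show "count M l \<le> 4 * K l"
          proof (rule ccontr)
            assume "\<not> count M l \<le> 4 * K l"
            then have s: "repeat_mset (K l) (unit l) \<subseteq># M" by (intro repeat_unit_subset) simp
            have "0 < l" using l less.prems(2) by (metis gr0I)
            then have k: "0 < K l" "good (2 * q - 1) (repeat_mset (K l) (unit l))" using K by auto
            have "repeat_mset (K l) (unit l) \<noteq> {#}" using k(1) by (auto simp: unit_def)
            moreover have "even_type (M - repeat_mset (K l) (unit l))"
              using even_type_add[of "repeat_mset (K l) (unit l)" "M - repeat_mset (K l) (unit l)"]
              by (simp add: subset_mset.add_diff_inverse[OF s] less.prems(1) even_type_unit)
            ultimately show False using False s k(2) by blast
          qed
        qed
        then have "sum_mset M \<le> \<Lambda> * (\<Sum>l<\<Lambda>. 4 * K l)" by (intro sum_mset_le_counts) blast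
        then show ?thesis using less.prems(1) good_empty by (intro exI[of _ "{#}"] exI[of _ M]) simp
      qed
    qed
  qed
qed

text \<open>The factorization into 2-cycles and 3-cycles places some excess of the remainder in a
  bounded interval, from which an absorbing part can cancel it.\<close>

lemma excess_bound:
  assumes "even_type R" "0 \<notin># R" "sum_mset R \<le> B"
  obtains e where "excess q R e" "\<bar>e\<bar> \<le> int ((q + 2) * B)"
proof -
  obtain a b where ab: "balanced R (replicate_mset a 3 + replicate_mset b 2)" "a + b \<le> sum_mset R"
    using ex_balanced_2_3[OF assms(1,2)] by blast
  have e: "excess q R (int b - (int q - 2) * int a)"
    using ab(1) by (intro excessI[of R _ a 0 b]) auto
  have "\<bar>int b - (int q - 2) * int a\<bar> \<le> int b + (int q + 2) * int a"
  proof -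
    have "(int q - 2) * int a = int q * int a - 2 * int a" "(int q + 2) * int a = int q * int a + 2 * int a"
      by (simp_all add: algebra_simps)
    moreover have "0 \<le> int q * int a" by simp
    ultimately show ?thesis by linarith
  qed
  also have "\<dots> \<le> (int q + 2) * int b + (int q + 2) * int a"
    using mult_right_mono[of 1 "int q + 2" "int b"] by simp
  also have "\<dots> = (int q + 2) * int (a + b)" by (simp add: algebra_simps)
  also have "\<dots> \<le> (int q + 2) * int B" using ab(2) assms(3) by (intro mult_left_mono) auto
  finally show thesis using that[OF e] by (simp add: algebra_simps)
qed

text \<open>One \<open>K\<close> serves all remainders, as their excesses lie in a finite interval.
  For \<open>l = 1\<close> the fixed points act as fillers instead.\<close>

lemma good_add_units:
  assumes "3 \<le> q" "0 < l"
  obtains K where "\<And>R. even_type R \<Longrightarrow> 0 \<notin># R \<Longrightarrow> sum_mset R \<le> B \<Longrightarrow>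
    good (2 * q - 1) (R + repeat_mset K (unit l))"
proof (cases "l = 1")
  case True
  have "good (2 * q - 1) (R + repeat_mset ((2 * q - 1) * B) (unit l))"
    if R: "even_type R" "0 \<notin># R" "sum_mset R \<le> B" for R
  proof -
    obtain a b where ab: "balanced R (replicate_mset a 3 + replicate_mset b 2)" "a + b \<le> sum_mset R"
      using ex_balanced_2_3[OF R(1,2)] by blast
    have "(2 * q - 1) * (a + b) \<le> (2 * q - 1) * B" using ab(2) R(3) by (intro mult_left_mono) auto
    then have "good (2 * q - 1) (R + replicate_mset ((2 * q - 1) * B) 1)"
      using assms(1) by (intro good_ones_add[OF ab(1)]) auto
    then show ?thesis using True by (simp add: unit_def repeat_mset_replicate_mset)
  qed
  then show thesis using that by blast
next
  case False
  have "\<exists>K. \<forall>k\<ge>K. excess q (repeat_mset k (unit l)) r" for r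
    using excess_units[of l q r] assms False by (metis One_nat_def Suc_leI le_neq_implies_less numeral_2_eq_2)
  then obtain K where K: "\<And>r k. K r \<le> k \<Longrightarrow> excess q (repeat_mset k (unit l)) r" by metis
  define I where "I = {- int ((q + 2) * B)..int ((q + 2) * B)}"
  \<comment> \<open>The sum over \<open>I\<close> is used only as a common upper bound of the
    thresholds \<open>K (- e)\<close>.\<close>
  have "good (2 * q - 1) (R + repeat_mset (\<Sum>e\<in>I. K (- e)) (unit l))"
    if R: "even_type R" "0 \<notin># R" "sum_mset R \<le> B" for R
  proof -
    obtain e where e: "excess q R e" "\<bar>e\<bar> \<le> int ((q + 2) * B)" using excess_bound[OF R] by blast
    then have "e \<in> I" by (simp only: I_def atLeastAtMost_iff) linarith
    then have "K (- e) \<le> (\<Sum>e\<in>I. K (- e))" by (intro member_le_sum) (auto simp: I_def)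
    from excess_add[OF e(1) K[OF this]] have "excess q (R + repeat_mset (\<Sum>e\<in>I. K (- e)) (unit l)) 0" by simp
    then show ?thesis by (rule excess_0_good) (rule assms)
  qed
  then show thesis using that by blast
qed

text \<open>An absorbing part \<open>L\<close> is reserved first: a cycle of length at least
  \<open>\<Lambda>\<close>, possibly with a partner, or many copies of one length. The rest is
  stripped to a remainder \<open>R\<close>, and \<open>L\<close> compensates for \<open>R\<close>.
  As \<open>L\<close> is fixed before \<open>R\<close> is known, it must work for every
  \<open>R\<close> of sum at most \<open>B\<close>.\<close>

theorem good_large:
  assumes "3 \<le> q"
  obtains N where "\<And>M. even_type M \<Longrightarrow> 0 \<notin># M \<Longrightarrow> N < sum_mset M \<Longrightarrow> good (2 * q - 1) M"
proof -
  obtain B where B: "\<And>M. even_type M \<Longrightarrow> 0 \<notin># M \<Longrightarrow>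
    \<exists>G R. M = G + R \<and> good (2 * q - 1) G \<and> even_type R \<and> sum_mset R \<le> B"
    using strip[OF assms] by blast
  obtain \<Lambda> where \<Lambda>: "\<And>M l. even_type M \<Longrightarrow> 0 \<notin># M \<Longrightarrow> l \<in># M \<Longrightarrow> \<Lambda> \<le> l \<Longrightarrow>
    \<exists>L. L \<subseteq># M \<and> L \<noteq> {#} \<and> even_type (M - L) \<and> (\<forall>e. \<bar>e\<bar> \<le> int ((q + 2) * B) \<longrightarrow> excess q L e)"
    using excess_long[OF assms, of "(q + 2) * B"] by blast
  have "\<forall>l. \<exists>K. 0 < l \<longrightarrow> (\<forall>R. even_type R \<longrightarrow> 0 \<notin># R \<longrightarrow> sum_mset R \<le> B \<longrightarrow>
      good (2 * q - 1) (R + repeat_mset K (unit l)))"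
  proof
    show "\<exists>K. 0 < l \<longrightarrow> (\<forall>R. even_type R \<longrightarrow> 0 \<notin># R \<longrightarrow> sum_mset R \<le> B \<longrightarrow>
        good (2 * q - 1) (R + repeat_mset K (unit l)))" for l
    proof (cases "0 < l")
      case True
      from good_add_units[OF assms this, of B] show ?thesis by blast
    qed simp
  qed
  from choice[OF this] obtain K where K: "\<And>l R. 0 < l \<Longrightarrow> even_type R \<Longrightarrow> 0 \<notin># R \<Longrightarrow> sum_mset R \<le> B \<Longrightarrow>
      good (2 * q - 1) (R + repeat_mset (K l) (unit l))" by blast
  show thesis
  proof (rule that)
    fix M assume M: "even_type M" "0 \<notin># M" "\<Lambda> * (\<Sum>l<\<Lambda>. 4 * K l) < sum_mset M"
    have "\<exists>L. L \<subseteq># M \<and> even_type (M - L) \<and>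
      (\<forall>R. even_type R \<longrightarrow> 0 \<notin># R \<longrightarrow> sum_mset R \<le> B \<longrightarrow> good (2 * q - 1) (R + L))"
    proof (cases "\<exists>l\<in>#M. \<Lambda> \<le> l")
      case True
      then obtain L where L: "L \<subseteq># M" "even_type (M - L)"
        "\<And>e. \<bar>e\<bar> \<le> int ((q + 2) * B) \<Longrightarrow> excess q L e" using \<Lambda>[OF M(1,2)] by metis
      have "good (2 * q - 1) (R + L)" if R: "even_type R" "0 \<notin># R" "sum_mset R \<le> B" for R
      proof -
        obtain e where "excess q R e" "\<bar>e\<bar> \<le> int ((q + 2) * B)" using excess_bound[OF R] by blast
        then have "excess q (R + L) 0" using excess_add[of q R e L "- e"] L(3)[of "- e"] by simp
        then show ?thesis by (rule excess_0_good) (rule assms)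
      qed
      then show ?thesis using L by blast
    next
      case False
      obtain l where l: "l \<in># M" "4 * K l < count M l"
      proof (rule ccontr)
        assume "\<not> thesis"
        then have "sum_mset M \<le> \<Lambda> * (\<Sum>l<\<Lambda>. 4 * K l)"
          using that False by (intro sum_mset_le_counts) (meson not_le)
        then show False using M(3) by simp
      qed
      have s: "repeat_mset (K l) (unit l) \<subseteq># M" using l by (intro repeat_unit_subset) simp
      have "0 < l" using l M(2) by (metis gr0I)
      moreover have "even_type (M - repeat_mset (K l) (unit l))"
        using even_type_add[of "repeat_mset (K l) (unit l)" "M - repeat_mset (K l) (unit l)"]
        by (simp add: subset_mset.add_diff_inverse[OF s] M(1) even_type_unit)
      ultimately show ?thesis using s K by blast
    qed
    then obtain L where L: "L \<subseteq># M" "even_type (M - L)" "\<And>R. even_type R \<Longrightarrow> 0 \<notin># R \<Longrightarrow>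
      sum_mset R \<le> B \<Longrightarrow> good (2 * q - 1) (R + L)" by blast
    have "0 \<notin># M - L" using M(2) by (meson in_diffD)
    then obtain G R where GR: "M - L = G + R" "good (2 * q - 1) G" "even_type R" "sum_mset R \<le> B"
      using B L(2) by blast
    have "0 \<notin># R" using \<open>0 \<notin># M - L\<close> GR(1) by simp
    then have "good (2 * q - 1) (G + (R + L))" using good_add GR L(3) by blast
    moreover have "M = G + (R + L)" using subset_mset.add_diff_inverse[OF L(1)] by (simp add: GR(1) ac_simps)
    ultimately show "good (2 * q - 1) M" by simp
  qed
qed

section \<open>Factorizations into 3-cycles\<close>

text \<open>Two points together with a gluing point form a 3-cycle, which goes into one factor only.
  The next 3-cycle must go into the other factor, so the two statements are proved simultaneously
  and each step of one uses the other.\<close>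

lemma ex_fac_3_cycles:
  assumes "distinct cs" "length cs = 2 * n + 1"
  shows "\<exists>ts. fac [cs] ts \<and> (\<forall>(i, j)\<in>set (sizes ts). i \<in> {1, 3} \<and> j \<in> {1, 3}) \<and> hd cs \<notin> pts (map snd ts)"
    and "\<exists>ts. fac [cs] ts \<and> (\<forall>(i, j)\<in>set (sizes ts). i \<in> {1, 3} \<and> j \<in> {1, 3}) \<and> hd cs \<notin> pts (map fst ts)"
  using assms
proof (induction n arbitrary: cs)
  case 0
  {
    case 1 show ?case using 1 by (intro exI[of _ "[]"]) (auto simp: fac_def length_Suc_conv)
  next
    case 2 show ?case using 2 by (intro exI[of _ "[]"]) (auto simp: fac_def length_Suc_conv)
  }
next
  case (Suc n)
  {
    case 1
    then obtain w0 w1 z r where cs: "cs = w0 # w1 # z # r" by (auto simp: length_Suc_conv)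
    have d: "distinct (w0 # w1 # z # r)" using 1(1) by (simp only: cs)
    obtain ts where ts: "fac [z # r] ts" "\<forall>(i, j)\<in>set (sizes ts). i \<in> {1, 3} \<and> j \<in> {1, 3}"
      "z \<notin> pts (map fst ts)"
      using Suc.IH(2)[of "z # r"] d 1(2) by (auto simp: cs)
    \<comment> \<open>The trivial partner sits at \<open>w1\<close>, since gluing keeps
      \<open>z\<close> out of the second factor and the claim keeps the head \<open>w0\<close> out
      of it.\<close>
    define t where "t = ([z, w0, w1], [w1])"
    have t: "fac [[z, w0, w1]] [t]" "z \<notin> pts (map snd [t])" using d by (auto simp: fac_def t_def)
    have "fac (([] @ [w0, w1] @ z # r) # [] @ []) (ts @ [t])"
      by (rule fac_glue) (use ts(1,3) t d in simp_all)
    then have "fac [cs] (ts @ [t])" by (simp add: cs)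
    moreover have "pts (map snd ts) \<subseteq> set (z # r)" using ts(1) by (auto simp: fac_def)
    then have "hd cs \<notin> pts (map snd (ts @ [t]))" using d by (auto simp: t_def cs)
    moreover have "\<forall>(i, j)\<in>set (sizes (ts @ [t])). i \<in> {1, 3} \<and> j \<in> {1, 3}" using ts(2) by (auto simp: t_def)
    ultimately show ?case by blast
  next
    case 2
    then obtain u0 u1 v where "cs = u0 # u1 # v" "v \<noteq> []" by (auto simp: length_Suc_conv)
    then obtain w z where cs: "cs = u0 # u1 # w @ [z]" by (metis append_butlast_last_id)
    have d: "distinct (u0 # u1 # w @ [z])" using 2(1) by (simp only: cs)
    obtain ts where ts: "fac [z # w] ts" "\<forall>(i, j)\<in>set (sizes ts). i \<in> {1, 3} \<and> j \<in> {1, 3}"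
      "z \<notin> pts (map snd ts)"
      using Suc.IH(1)[of "z # w"] d 2(2) by (auto simp: cs)
    define t where "t = ([u1], [u0, u1, z])"
    have t: "fac [[u0, u1, z]] [t]" "z \<notin> pts (map fst [t])" using d by (auto simp: fac_def t_def)
    have "fac (([u0, u1] @ w @ z # []) # [] @ []) ([t] @ ts)"
      by (rule fac_glue) (use ts(1,3) t d in simp_all)
    then have "fac [cs] ([t] @ ts)" by (simp add: cs)
    moreover have "pts (map fst ts) \<subseteq> set (z # w)" using ts(1) by (auto simp: fac_def)
    then have "hd cs \<notin> pts (map fst ([t] @ ts))" using d by (auto simp: t_def cs)
    moreover have "\<forall>(i, j)\<in>set (sizes ([t] @ ts)). i \<in> {1, 3} \<and> j \<in> {1, 3}" using ts(2) by (auto simp: t_def)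
    ultimately show ?case by blast
  }
qed

text \<open>One point of each cycle is split off. The resulting two transpositions give the pair
  \<open>t\<close> of 3-cycles, glued to the odd rests at \<open>v\<close> and
  \<open>y\<close>.\<close>

lemma ex_fac_3_cycles_even_pair:
  fixes cs ds :: "'a list"
  assumes "distinct (cs @ ds)" "length cs = 2 * n + 2" "length ds = 2 * m + 2"
  shows "\<exists>ts. fac [cs, ds] ts \<and> (\<forall>(i, j)\<in>set (sizes ts). i \<in> {1, 3} \<and> j \<in> {1, 3})"
proof -
  obtain e v r where cs: "cs = e # v # r" using assms(2) by (auto simp: length_Suc_conv)
  define f w y where "f = hd ds" and "w = butlast (tl ds)" and "y = last ds"
  have ds: "ds = f # w @ [y]" using assms(3) by (cases ds) (auto simp: f_def w_def y_def)
  have d: "distinct (e # v # r @ f # w @ [y])" using assms(1) by (simp add: cs ds)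
  obtain ts where ts: "fac [v # r] ts" "\<forall>(i, j)\<in>set (sizes ts). i \<in> {1, 3} \<and> j \<in> {1, 3}"
    "v \<notin> pts (map fst ts)"
    using ex_fac_3_cycles(2)[of "v # r" n] d assms(2) by (auto simp: cs)
  obtain us where us: "fac [y # w] us" "\<forall>(i, j)\<in>set (sizes us). i \<in> {1, 3} \<and> j \<in> {1, 3}"
    "y \<notin> pts (map snd us)"
    using ex_fac_3_cycles(1)[of "y # w" m] d assms(3) by (auto simp: ds)
  define t where "t = ([v, e, f], [e, f, y])"
  have t: "fac [[v, e], [f, y]] [t]" using fac_two_transpositions[of v e f y] d by (auto simp: t_def)
  have "fac (([] @ [e] @ v # r) # [] @ [[f, y]]) (ts @ [t])"
    by (rule fac_glue) (use ts(1,3) t d in \<open>auto simp: t_def\<close>)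
  then have f1: "fac [[f, y], cs] (ts @ [t])"
    by (rule fac_mset_cycles) (use d in \<open>auto simp: cs\<close>)
  have "pts (map fst ts) \<subseteq> set (v # r)" using ts(1) unfolding fac_def by auto
  then have ynin: "y \<notin> pts (map fst (ts @ [t]))" using d by (auto simp: t_def)
  have dd: "distinct (concat [f # w @ [y], cs])" using d unfolding cs by auto
  have "fac (([f] @ w @ y # []) # [cs] @ []) ((ts @ [t]) @ us)"
    by (rule fac_glue) (use f1 us(1,3) ynin dd in simp_all)
  then have "fac [f # w @ [y], cs] ((ts @ [t]) @ us)" by simp
  then have "fac [cs, ds] ((ts @ [t]) @ us)"
    unfolding ds by (rule fac_mset_cycles) (use dd in simp_all)
  moreover have "\<forall>(i, j)\<in>set (sizes ((ts @ [t]) @ us)). i \<in> {1, 3} \<and> j \<in> {1, 3}"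
    using ts(2) us(2) by (auto simp: t_def)
  ultimately show ?thesis by blast
qed

theorem good_3:
  assumes "even_type M" "0 \<notin># M" shows "good 3 M"
  using assms
proof (induction "size M" arbitrary: M rule: less_induct)
  case less
  show ?case
    using less.prems(1)
  proof (cases rule: even_type_cases)
    case 1
    then show ?thesis using good_empty by simp
  next
    case (2 l M')
    then have "size M' < size M" "0 \<notin># M'" "even_type M'" using less.prems(2) by simp_all
    then have g: "good 3 M'" using less.hyps by blast
    obtain n where n: "l = 2 * n + 1" using 2(2) by (blast elim: oddE)
    have "good 3 {#l#}"
    proof (rule realizes_1)
      fix cs :: "nat list" assume "distinct cs" "length cs = l"
      then obtain ts where "fac [cs] ts" "\<forall>(i, j)\<in>set (sizes ts). i \<in> {1, 3} \<and> j \<in> {1, 3}"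
        using ex_fac_3_cycles(1)[of cs n] n by blast
      then show "\<exists>ts. fac [cs] ts \<and> (\<forall>(i, j)\<in>#mset (sizes ts). i \<in> {1, 3} \<and> j \<in> {1, 3})"
        unfolding set_mset_mset by blast
    qed
    from good_add[OF this g] show ?thesis by (simp only: 2(1) add_mset_add_single[of l M'] add.commute)
  next
    case (3 l m M')
    then have "size M' < size M" "0 \<notin># M'" "even_type M'" using less.prems(2) by simp_all
    then have g: "good 3 M'" using less.hyps by blast
    have nz: "l \<noteq> 0" "m \<noteq> 0" using 3(1) less.prems(2) by auto
    obtain n where n: "l = 2 * n + 2" using even_pos_eq[OF 3(2) nz(1)] ..
    obtain k where k: "m = 2 * k + 2" using even_pos_eq[OF 3(3) nz(2)] ..
    have "good 3 {#l, m#}"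
    proof (rule realizes_2)
      fix cs ds :: "nat list" assume a: "distinct (cs @ ds)" "length cs = l" "length ds = m"
      show "\<exists>ts. fac [cs, ds] ts \<and> (\<forall>(i, j)\<in>#mset (sizes ts). i \<in> {1, 3} \<and> j \<in> {1, 3})"
        unfolding set_mset_mset
        by (rule ex_fac_3_cycles_even_pair[OF a(1), of n k]) (use a n k in simp_all)
    qed
    from good_add[OF this g] have "good 3 ({#l, m#} + M')" .
    moreover have "M = {#l, m#} + M'" by (simp add: 3(1))
    ultimately show ?thesis by (simp only:)
  qed
qed

section \<open>The width of the alternating group\<close>

text \<open>Empty cycles are discarded, while fixed points in \<open>I\<close> remain as cycles of
  length 1.\<close>

lemma cycle_decomp_imp_prodc:
  "cycle_decomp I g \<Longrightarrow> \<exists>css. distinct (concat css) \<and> pts css = I \<and> prodc css = g \<and> [] \<notin> set css"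
proof (induction rule: cycle_decomp.induct)
  case empty
  show ?case by (intro exI[of _ "[]"]) simp
next
  case (comp I g cs)
  then obtain css where css: "distinct (concat css)" "pts css = I" "prodc css = g" "[] \<notin> set css" by blast
  show ?case
  proof (cases "cs = []")
    case True
    then show ?thesis using css by (intro exI[of _ css]) auto
  next
    case False
    then show ?thesis using css comp.hyps by (intro exI[of _ "cs # css"]) auto
  qed
qed

lemma evenperm_cyc: "distinct c \<Longrightarrow> c \<noteq> [] \<Longrightarrow> evenperm (cyc c) \<longleftrightarrow> odd (length c)"
proof (induction c rule: cycle_of_list.induct)
  case (1 i j c)
  have "evenperm (cyc (i # j # c)) \<longleftrightarrow> evenperm (transpose i j) = evenperm (cyc (j # c))"
    unfolding cycle_of_list.simps(1) by (rule evenperm_comp[OF permutation_swap_id permutation_of_cycle])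
  also have "\<dots> \<longleftrightarrow> odd (length (i # j # c))" using 1 by (auto simp: evenperm_swap)
  finally show ?case .
qed (auto simp: length_Suc_conv evenperm_id)

lemma permutation_prodc: "permutation (prodc cs)"
  unfolding permutation_permutes using prodc_permutes[of cs] finite_set by blast

lemma evenperm_prodc:
  "distinct (concat css) \<Longrightarrow> [] \<notin> set css \<Longrightarrow> evenperm (prodc css) \<longleftrightarrow> even_type (mset (map length css))"
proof (induction css)
  case (Cons c css)
  have "evenperm (prodc (c # css)) \<longleftrightarrow> evenperm (cyc c) = evenperm (prodc css)"
    unfolding prodc.simps by (rule evenperm_comp[OF permutation_of_cycle permutation_prodc])
  also have "\<dots> \<longleftrightarrow> even_type (mset (map length (c # css)))" using Cons by (auto simp: evenperm_cyc)
  finally show ?case .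
qed (simp add: evenperm_id)

text \<open>The sign is multiplicative, so an odd power of \<open>a\<close> has the sign of
  \<open>a\<close>.\<close>

lemma evenperm_odd_root:
  assumes "permutation a" "a ^^ n = id" "odd n" shows "evenperm a"
proof -
  have "evenperm (a ^^ k) \<longleftrightarrow> even k \<or> evenperm a" for k
  proof (induction k)
    case (Suc k)
    have "evenperm (a ^^ Suc k) \<longleftrightarrow> evenperm a = evenperm (a ^^ k)"
      unfolding funpow.simps by (intro evenperm_comp permutation_funpow assms(1))
    then show ?case using Suc by (auto simp del: funpow.simps)
  qed simp
  from this[of n] show ?thesis using assms(2,3) by (simp add: evenperm_id)
qed

section \<open>Elements of order \<open>p\<close> in the alternating group\<close>

lemma alt_group_pow: "a [^]\<^bsub>alt_group n\<^esub> (k::nat) = a ^^ k"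
  by (induction k) (simp_all add: nat_pow_def alt_group_one alt_group_mult funpow_swap1 fun_eq_iff)

lemma prime_root_in_alt_group:
  assumes "prime p" "odd p" "a permutes {1..n}" "a ^^ p = id"
  shows "a = id \<or> a \<in> elements_of_order p (alt_group n)"
proof -
  interpret group "alt_group n" by (rule alt_group_is_group)
  have "permutation a" using assms(3) unfolding permutation_permutes by blast
  then have a: "a \<in> carrier (alt_group n)"
    using assms evenperm_odd_root by (auto simp: alt_group_carrier)
  then have "ord a dvd p" using assms(4) by (simp add: alt_group_pow alt_group_one flip: pow_eq_id)
  then consider "ord a = 1" | "ord a = p" using assms(1) prime_nat_iff by blast
  then show ?thesis
  proof cases
    case 1
    then show ?thesis using ord_eq_1[OF a] by (simp add: alt_group_one)
  next
    case 2
    then show ?thesis using a by (simp add: elements_of_order_def)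
  qed
qed

lemma good_imp_product_of_two:
  assumes "prime p" "odd p" "good p (mset (map length css))" "distinct (concat css)" "pts css = {1..n}"
  shows "product_of_at_most (alt_group n) (elements_of_order p (alt_group n)) 2 (prodc css)"
proof -
  obtain ts where ts: "fac css ts" "\<forall>(i, j)\<in>#mset (sizes ts). i \<in> {1, p} \<and> j \<in> {1, p}"
    using assms(3,4) unfolding realizes_def by blast
  define a b where "a = prodc (map fst ts)" and "b = prodc (map snd ts)"
  have "a permutes {1..n}" "b permutes {1..n}"
    using ts(1) assms(5) unfolding fac_def a_def b_def
    by (metis permutes_subset prodc_permutes)+
  moreover have "a ^^ p = id" "b ^^ p = id"
    unfolding a_def b_def using ts by (intro prodc_root; fastforce simp: fac_def)+
  ultimately have ab: "a = id \<or> a \<in> elements_of_order p (alt_group n)" "b = id \<or> b \<in> elements_of_order p (alt_group n)"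
    using prime_root_in_alt_group assms(1,2) by blast+
  have g: "prodc css = a \<circ> b" using ts(1) by (simp add: fac_def a_def b_def)
  show ?thesis
    unfolding product_of_at_most_def g
    \<comment> \<open>Trivial factors are dropped, as the identity does not have order
      \<open>p\<close>.\<close>
    by (rule exI[of _ "filter (\<lambda>x. x \<noteq> id) [a, b]"])
      (use ab in \<open>auto simp: alt_group_mult alt_group_one\<close>)
qed

section \<open>The lower bound and the conclusion\<close>

text \<open>\<open>(1 2)(3 4)\<close> is even, nontrivial and of order dividing 2, whereas at most
  one element of order \<open>p >= 3\<close> gives the identity or an element of order
  \<open>p\<close>.\<close>

lemma not_product_of_one:
  assumes "3 \<le> p" "4 \<le> n"
    "\<forall>g\<in>carrier (alt_group n). product_of_at_most (alt_group n) (elements_of_order p (alt_group n)) k g"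
  shows "2 \<le> k"
proof (rule ccontr)
  interpret group "alt_group n" by (rule alt_group_is_group)
  define t :: "nat \<Rightarrow> nat" where "t = transpose 1 2 \<circ> transpose 3 4"
  assume "\<not> 2 \<le> k"
  have "t permutes {1..n}" unfolding t_def
    using assms(2) by (intro permutes_compose permutes_swap_id) auto
  moreover have "evenperm t" by (simp add: t_def evenperm_comp permutation_swap_id evenperm_swap)
  ultimately have t: "t \<in> carrier (alt_group n)" by (simp add: alt_group_carrier)
  have "t \<circ> t = id" by (auto simp: t_def fun_eq_iff transpose_def)
  then have "t ^^ 2 = id" by (simp add: numeral_2_eq_2)
  then have "t [^]\<^bsub>alt_group n\<^esub> (2::nat) = \<one>\<^bsub>alt_group n\<^esub>" by (simp only: alt_group_pow alt_group_one)
  then have "ord t dvd 2" using pow_eq_id[OF t] by blast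
  then have "ord t \<noteq> p" using assms(1) by (auto dest: dvd_imp_le)
  moreover have "t 1 = 2" by (simp add: t_def transpose_def)
  then have "t \<noteq> id" by auto
  moreover obtain xs where xs: "length xs \<le> k" "set xs \<subseteq> elements_of_order p (alt_group n)"
    "t = foldr (\<otimes>\<^bsub>alt_group n\<^esub>) xs \<one>\<^bsub>alt_group n\<^esub>"
    using assms(3) t unfolding product_of_at_most_def by blast
  moreover have "xs = [] \<or> (\<exists>x. xs = [x])"
  proof -
    have "length xs \<le> 1" using xs(1) \<open>\<not> 2 \<le> k\<close> by simp
    then show ?thesis by (cases xs) auto
  qed
  ultimately show False by (auto simp: alt_group_mult alt_group_one elements_of_order_def)
qed

theorem theorem2p7:
  fixes p :: nat
  assumes "prime p" and "p \<ge> 3"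
  shows "\<exists>N::nat. \<forall>n>N. p_width p (alt_group n) = 2"
proof -
  have "odd p" using prime_odd_nat[OF assms(1)] assms(2) by simp
  have "\<exists>N. \<forall>M. even_type M \<longrightarrow> 0 \<notin># M \<longrightarrow> N < sum_mset M \<longrightarrow> good p M"
  proof (cases "p = 3")
    case True
    then show ?thesis using good_3 by blast
  next
    case False
    then obtain q where q: "p = 2 * q - 1" "3 \<le> q"
    proof -
      obtain k where "p = 2 * k + 1" using \<open>odd p\<close> by (blast elim: oddE)
      then show thesis using that[of "k + 1"] assms(2) False by simp
    qed
    show ?thesis using good_large[OF q(2)] unfolding q(1) by blast
  qed
  then obtain N where N: "\<And>M. even_type M \<Longrightarrow> 0 \<notin># M \<Longrightarrow> N < sum_mset M \<Longrightarrow> good p M" by blast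
  \<comment> \<open>The summand 4 provides the four points of the lower bound.\<close>
  have "p_width p (alt_group n) = 2" if n: "N + 4 < n" for n
  proof -
    let ?A = "{k. \<forall>g\<in>carrier (alt_group n). product_of_at_most (alt_group n) (elements_of_order p (alt_group n)) k g}"
    have "product_of_at_most (alt_group n) (elements_of_order p (alt_group n)) 2 g"
      if "g \<in> carrier (alt_group n)" for g
    proof -
      have g: "g permutes {1..n}" "evenperm g" using that by (auto simp: alt_group_carrier)
      obtain css where css: "distinct (concat css)" "pts css = {1..n}" "prodc css = g" "[] \<notin> set css"
        using cycle_decomp_imp_prodc[OF cycle_decomposition[OF g(1)]] by auto
      have "even_type (mset (map length css))" using evenperm_prodc[OF css(1,4)] g(2) css(3) by simp
      moreover have "sum_mset (mset (map length css)) = n"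
      proof -
        have "sum_mset (mset (map length css)) = length (concat css)" by (simp only: length_concat sum_mset_sum_list)
        also have "\<dots> = card (pts css)" using distinct_card[OF css(1)] by simp
        finally show ?thesis unfolding css(2) by simp
      qed
      moreover have "0 \<notin># mset (map length css)" using css(4) by auto
      ultimately have "good p (mset (map length css))" using N n by simp
      from good_imp_product_of_two[OF assms(1) \<open>odd p\<close> this css(1,2)] css(3) show ?thesis by simp
    qed
    then have "2 \<in> ?A" by blast
    moreover have "2 \<le> k" if "k \<in> ?A" for k
      using not_product_of_one[OF assms(2), of n k] that n by simp
    ultimately have "(INF k\<in>?A. enat k) = enat 2"
      by (intro antisym INF_lower INF_greatest) auto
    then show ?thesis by (simp add: p_width_def numeral_eq_enat)
  qed
  then show ?thesis by blast
qed

end
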